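(* Let $a\in(0,1)$ be a constant and let $\epsilon\in(0,1)$. Suppose $k\le \log^a n$. Then, for all sufficiently large $n$, no algorithm (even a fully randomized one) for the $k$-secretary problem that processes the elements in an order drawn from some probability distribution on $\Pi_n$ with entropy $H\le \frac{1-\epsilon}{9}\log\log n$ can achieve expected competitive ratio at least $1-\epsilon$.
   Context: $\Pi_n$ is the set of all permutations of $[n]=\{1,\dots,n\}$. In the $k$-secretary problem ($1\le k\le n$), an adversary, knowing the algorithm and the distribution of orders, assigns real values to the $n$ elements; the algorithm inspects the elements one by one in the order given by a permutation drawn from its distribution on $\Pi_n$, learning each value upon inspection and irrevocably accepting or rejecting it, and accepts exactly $k$ elements (if only $k-i$ elements remain after $i$ acceptances, it must accept them). Expected competitive ratio at least $\alpha$ means: for every adversarial assignment, the expected sum of accepted values is at least $\alpha$ times the sum of the $k$ largest values. Entropy of a distribution $p$ is $-\sum_\pi p(\pi)\log p(\pi)$, $\log$ base 2. *)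

theory Defs
  imports "HOL-Probability.Probability" "HOL-Combinatorics.Permutations"
begin

text \<open>
  Elements are the numbers \<open>1, \<dots>, n\<close>. An order is a permutation \<open>\<pi>\<close> of \<open>{1..n}\<close>, where
  \<open>\<pi> i\<close> is the element inspected at time \<open>i\<close>.
\<close>

definition order_distribution :: "nat \<Rightarrow> (nat \<Rightarrow> nat) pmf \<Rightarrow> bool" where
  "order_distribution n D \<longleftrightarrow> set_pmf D \<subseteq> {\<pi>. \<pi> permutes {1..n}}"

text \<open>Since \<open>log 2 0 = 0\<close>, orders of probability zero contribute nothing.\<close>

definition order_entropy :: "nat \<Rightarrow> (nat \<Rightarrow> nat) pmf \<Rightarrow> real" where
  "order_entropy n D = - (\<Sum>\<pi> | \<pi> permutes {1..n}. pmf D \<pi> * log 2 (pmf D \<pi>))"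

definition observed :: "(nat \<Rightarrow> nat) \<Rightarrow> (nat \<Rightarrow> real) \<Rightarrow> nat \<Rightarrow> real list" where
  "observed \<pi> v t = map (\<lambda>i. v (\<pi> i)) [1..<Suc t]"

text \<open>
  A decision rule maps the values seen so far, the current one being last, to the wish to accept
  the current element. The wish is overridden so that exactly \<open>k\<close> elements are accepted: nothing
  is accepted after the \<open>k\<close>-th acceptance, and if the \<open>n - t\<close> elements that remain after \<open>t\<close> steps
  are all needed to reach \<open>k\<close>, they are accepted.
\<close>

primrec accepted ::
  "nat \<Rightarrow> nat \<Rightarrow> (real list \<Rightarrow> bool) \<Rightarrow> (nat \<Rightarrow> nat) \<Rightarrow> (nat \<Rightarrow> real) \<Rightarrow> nat \<Rightarrow> nat set" where
  "accepted n k rule \<pi> v 0 = {}"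
| "accepted n k rule \<pi> v (Suc t) =
     (let A = accepted n k rule \<pi> v t in
      if card A < k \<and> (rule (observed \<pi> v (Suc t)) \<or> n - t \<le> k - card A)
      then insert (\<pi> (Suc t)) A else A)"

lemma card_accepted:
  assumes "\<pi> permutes {1..n}" "k \<le> n"
  shows "card (accepted n k rule \<pi> v n) = k"
proof -
  have inj: "inj \<pi>" using assms(1) by (rule permutes_inj)
  have "accepted n k rule \<pi> v t \<subseteq> \<pi> ` {1..t} \<and> card (accepted n k rule \<pi> v t) \<le> k \<and>
        k \<le> card (accepted n k rule \<pi> v t) + (n - t)" if "t \<le> n" for t
    using that
  proof (induction t)
    case 0
    then show ?case using assms(2) by simp
  next
    case (Suc t)
    let ?A = "accepted n k rule \<pi> v t"
    have sub: "?A \<subseteq> \<pi> ` {1..t}" using Suc by simp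
    have "finite ?A" using sub by (rule finite_subset) simp
    moreover have "\<pi> (Suc t) \<notin> ?A"
    proof
      assume "\<pi> (Suc t) \<in> ?A"
      then obtain i where "i \<in> {1..t}" "\<pi> (Suc t) = \<pi> i" using sub by blast
      then show False using injD[OF inj, of "Suc t" i] by simp
    qed
    ultimately have "card (insert (\<pi> (Suc t)) ?A) = Suc (card ?A)" by simp
    moreover have "?A \<subseteq> \<pi> ` {1..Suc t}" using sub by force
    ultimately show ?case using Suc by (auto simp: Let_def)
  qed
  from this[of n] show ?thesis by simp
qed

text \<open>
  A randomized algorithm: the seed \<open>\<omega>\<close>, drawn from an arbitrary probability space \<open>M\<close> independently
  of the order, together with the order \<open>\<pi>\<close> determines a decision rule. The algorithm may use all
  of \<open>\<pi>\<close>, including the identities of elements not yet inspected, but of the values it knows only those already inspected.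
\<close>

type_synonym 's algorithm = "'s \<Rightarrow> (nat \<Rightarrow> nat) \<Rightarrow> real list \<Rightarrow> bool"

definition randomized_algorithm :: "'s measure \<Rightarrow> 's algorithm \<Rightarrow> bool" where
  "randomized_algorithm M alg \<longleftrightarrow>
     prob_space M \<and> (\<forall>\<pi> vs. {\<omega> \<in> space M. alg \<omega> \<pi> vs} \<in> sets M)"

definition expected_value ::
  "nat \<Rightarrow> nat \<Rightarrow> (nat \<Rightarrow> nat) pmf \<Rightarrow> 's measure \<Rightarrow> 's algorithm \<Rightarrow> (nat \<Rightarrow> real) \<Rightarrow> real" where
  "expected_value n k D M alg v =
     measure_pmf.expectation D (\<lambda>\<pi>. \<integral>\<omega>. sum v (accepted n k (alg \<omega> \<pi>) \<pi> v n) \<partial>M)"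

definition sum_largest :: "nat \<Rightarrow> nat \<Rightarrow> (nat \<Rightarrow> real) \<Rightarrow> real" where
  "sum_largest n k v = sum_list (take k (rev (sort (map v [1..<Suc n]))))"

text \<open>
  Values are nonnegative: were negative ones allowed, assigning \<open>-1\<close> to every element would rule
  out every ratio below 1 for every algorithm.
\<close>

definition achieves_ratio ::
  "nat \<Rightarrow> nat \<Rightarrow> (nat \<Rightarrow> nat) pmf \<Rightarrow> 's measure \<Rightarrow> 's algorithm \<Rightarrow> real \<Rightarrow> bool" where
  "achieves_ratio n k D M alg \<alpha> \<longleftrightarrow>
     (\<forall>v. (\<forall>i\<in>{1..n}. 0 \<le> v i) \<longrightarrow> expected_value n k D M alg v \<ge> \<alpha> * sum_largest n k v)"

end

theory Submission
  imports Defs "HOL-Real_Asymp.Real_Asymp"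
begin

text \<open>
  Few orders mean few bits of structure: at most \<open>1 / p\<close> orders have probability \<open>\<ge> p\<close>, and the entropy
  bounds the probability of all others, so we may work with at most \<open>sqrt (log 2 n)\<close> orders. Separating
  two sets for one order costs a factor 2 of their size; hence \<open>{1..n}\<close> contains a deep complete
  binary tree such that every one of these orders runs through the two subtrees of any node one
  after the other. The adversary hides in this tree, at a random place, a nested configuration with
  a random number \<open>h\<close> of layers: a configuration of \<open>h + 1\<close> layers consists of two configurations of
  \<open>h\<close> layers on different scales, one below each child of a random node. When the first half of a
  configuration has been inspected, the algorithm can hardly tell whether the second half will
  follow, and if so on which scale. Thus the acceptances spent on layer \<open>h\<close> are of use for layer
  \<open>h + 1\<close> only with probability 1/2, and summing over \<open>h\<close> shows that the average success is
  small. Values occur in clusters of \<open>k\<close> elements, so that \<open>k\<close> acceptances are worth no more than one.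
\<close>

section \<open>Common tree structure of few orders\<close>

datatype etree = Leaf "nat set" | Node etree etree

primrec elems :: "etree \<Rightarrow> nat set" where
  "elems (Leaf C) = C"
| "elems (Node l r) = elems l \<union> elems r"

primrec full :: "nat \<Rightarrow> nat \<Rightarrow> etree \<Rightarrow> bool" where
  "full k d (Leaf C) \<longleftrightarrow> d = 0 \<and> finite C \<and> card C = k"
| "full k d (Node l r) \<longleftrightarrow>
     (\<exists>e. d = Suc e \<and> full k e l \<and> full k e r \<and> elems l \<inter> elems r = {})"

text \<open>Here \<open>\<tau>\<close> gives the inspection time of an element. It is later
  instantiated by \<open>inv \<pi>\<close>, since \<open>\<pi>\<close> itself maps times to
  elements.\<close>

definition before :: "(nat \<Rightarrow> nat) \<Rightarrow> nat set \<Rightarrow> nat set \<Rightarrow> bool" where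
  "before \<tau> A B \<longleftrightarrow> (\<forall>x\<in>A. \<forall>y\<in>B. \<tau> x < \<tau> y)"

primrec compatible :: "(nat \<Rightarrow> nat) \<Rightarrow> etree \<Rightarrow> bool" where
  "compatible \<tau> (Leaf C) \<longleftrightarrow> True"
| "compatible \<tau> (Node l r) \<longleftrightarrow>
     (before \<tau> (elems l) (elems r) \<or> before \<tau> (elems r) (elems l)) \<and>
     compatible \<tau> l \<and> compatible \<tau> r"

lemma before_subset: "before \<tau> A B \<Longrightarrow> A' \<subseteq> A \<Longrightarrow> B' \<subseteq> B \<Longrightarrow> before \<tau> A' B'"
  by (auto simp: before_def)

text \<open>Sweep time until one of the sets first has \<open>q\<close> inspected elements. By
  injectivity at most one element is inspected at that moment, so the other set has at most
  \<open>q\<close> elements behind it and at least \<open>q\<close> still to come. The early part of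
  the one and the late part of the other are separated.\<close>

lemma before_halves:
  fixes A B :: "nat set"
  assumes inj: "inj \<tau>" and A: "finite A" "2 * q \<le> card A" and B: "finite B" "2 * q \<le> card B"
  obtains A' B' where "A' \<subseteq> A" "B' \<subseteq> B" "q \<le> card A'" "q \<le> card B'"
    "before \<tau> A' B' \<or> before \<tau> B' A'"
proof (cases "q = 0")
  case True
  then show ?thesis using that[of "{}" "{}"] by (simp add: before_def)
next
  case False
  define cnt where "cnt S t = card {x \<in> S. \<tau> x \<le> t}" for S t
  define P where "P t \<longleftrightarrow> q \<le> cnt A t \<or> q \<le> cnt B t" for t
  have "{x \<in> A. \<tau> x \<le> Max (\<tau> ` A)} = A" using A(1) by auto
  then have "P (Max (\<tau> ` A))" using A(2) by (auto simp: P_def cnt_def)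
  then have Pt: "P (LEAST t. P t)" by (rule LeastI)
  define t where "t = (LEAST t. P t)"
  have few: "cnt S t \<le> q" if S: "finite S" "S = A \<or> S = B" for S
  proof -
    have sub: "{x \<in> S. \<tau> x \<le> t} \<subseteq> {x \<in> S. \<tau> x < t} \<union> (\<tau> -` {t})" by auto
    have "finite (\<tau> -` {t})" "card (\<tau> -` {t}) \<le> 1"
      using card_vimage_inj_on_le[OF inj, of "{t}"] finite_vimageI[OF _ inj, of "{t}"] by auto
    then have "card ({x \<in> S. \<tau> x < t} \<union> \<tau> -` {t}) \<le> card {x \<in> S. \<tau> x < t} + 1"
      by (intro card_Un_le[THEN order_trans]) simp
    moreover have "cnt S t \<le> card ({x \<in> S. \<tau> x < t} \<union> \<tau> -` {t})"
      unfolding cnt_def using sub S(1) \<open>finite (\<tau> -` {t})\<close> by (intro card_mono) auto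
    ultimately have "cnt S t \<le> card {x \<in> S. \<tau> x < t} + 1" by linarith
    \<comment> \<open>By minimality of \<open>t\<close> no earlier time reaches \<open>q\<close>;
      for \<open>t = 0\<close> the count is 0, and \<open>q\<close> is positive here.\<close>
    moreover have "card {x \<in> S. \<tau> x < t} < q"
    proof (cases t)
      case 0
      then show ?thesis using False by simp
    next
      case (Suc s)
      have "\<not> P s" using not_less_Least[of s P] Suc t_def by simp
      then show ?thesis using S(2) Suc by (auto simp: P_def cnt_def less_Suc_eq_le)
    qed
    ultimately show ?thesis by simp
  qed
  have late: "q \<le> card {x \<in> S. t < \<tau> x}" if S: "finite S" "2 * q \<le> card S" "S = A \<or> S = B" for S
  proof -
    have "S = {x \<in> S. \<tau> x \<le> t} \<union> {x \<in> S. t < \<tau> x}" by auto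
    then have "card S \<le> cnt S t + card {x \<in> S. t < \<tau> x}"
      unfolding cnt_def by (metis card_Un_le)
    then show ?thesis using few[OF S(1,3)] S(2) by simp
  qed
  from Pt consider "q \<le> cnt A t" | "q \<le> cnt B t" unfolding P_def t_def by blast
  then show ?thesis
  proof cases
    case 1
    show ?thesis
      by (rule that[of "{x \<in> A. \<tau> x \<le> t}" "{x \<in> B. t < \<tau> x}"])
        (use 1 late[OF B] in \<open>auto simp: before_def cnt_def\<close>)
  next
    case 2
    show ?thesis
      by (rule that[of "{x \<in> A. t < \<tau> x}" "{x \<in> B. \<tau> x \<le> t}"])
        (use 2 late[OF A] in \<open>auto simp: before_def cnt_def\<close>)
  qed
qed

text \<open>The orders are treated one by one, each halving both sets. Separation in one order
  survives the passage to subsets made for the others.\<close>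

lemma before_common:
  fixes A B :: "nat set"
  assumes "finite \<Gamma>" "\<And>\<tau>. \<tau> \<in> \<Gamma> \<Longrightarrow> inj \<tau>"
    and "finite A" "2 ^ card \<Gamma> * q \<le> card A" "finite B" "2 ^ card \<Gamma> * q \<le> card B"
  shows "\<exists>A' B'. A' \<subseteq> A \<and> B' \<subseteq> B \<and> q \<le> card A' \<and> q \<le> card B' \<and>
    (\<forall>\<tau>\<in>\<Gamma>. before \<tau> A' B' \<or> before \<tau> B' A')"
  using assms
proof (induction \<Gamma> arbitrary: A B rule: finite_induct)
  case empty
  then show ?case by auto
next
  case (insert \<tau> \<Gamma>)
  have "2 * (2 ^ card \<Gamma> * q) \<le> card A" "2 * (2 ^ card \<Gamma> * q) \<le> card B"
    using insert by (simp_all add: mult.assoc)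
  then obtain A1 B1 where 1: "A1 \<subseteq> A" "B1 \<subseteq> B" "2 ^ card \<Gamma> * q \<le> card A1"
      "2 ^ card \<Gamma> * q \<le> card B1" "before \<tau> A1 B1 \<or> before \<tau> B1 A1"
    using before_halves[of \<tau> A "2 ^ card \<Gamma> * q" B] insert.prems by blast
  then obtain A2 B2 where "A2 \<subseteq> A1" "B2 \<subseteq> B1" "q \<le> card A2" "q \<le> card B2"
      "\<forall>\<tau>\<in>\<Gamma>. before \<tau> A2 B2 \<or> before \<tau> B2 A2"
    using insert.IH[of A1 B1] insert.prems finite_subset[OF 1(1)] finite_subset[OF 1(2)] by auto
  with 1 have "before \<tau> A2 B2 \<or> before \<tau> B2 A2" by (meson before_subset)
  with 1 \<open>A2 \<subseteq> A1\<close> \<open>B2 \<subseteq> B1\<close> \<open>q \<le> card A2\<close> \<open>q \<le> card B2\<close>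
    \<open>\<forall>\<tau>\<in>\<Gamma>. before \<tau> A2 B2 \<or> before \<tau> B2 A2\<close>
  show ?case by (intro exI[of _ A2] exI[of _ B2]) auto
qed

text \<open>One level costs the factor \<open>2 ^ (card \<Gamma> + 1)\<close>: one halving cuts
  \<open>S\<close> into two disjoint parts, and \<open>card \<Gamma>\<close> further ones separate
  these parts in every order.\<close>

lemma compatible_tree_exists:
  assumes \<Gamma>: "finite \<Gamma>" "\<And>\<tau>. \<tau> \<in> \<Gamma> \<Longrightarrow> inj \<tau>"
    and "finite S" "k * 2 ^ ((card \<Gamma> + 1) * d) \<le> card S"
  shows "\<exists>t. full k d t \<and> elems t \<subseteq> S \<and> (\<forall>\<tau>\<in>\<Gamma>. compatible \<tau> t)"
  using assms(3,4)
proof (induction d arbitrary: S)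
  case 0
  then obtain C where "C \<subseteq> S" "card C = k" using obtain_subset_with_card_n[of k S] by auto
  then show ?case using 0 by (intro exI[of _ "Leaf C"]) (auto intro: finite_subset)
next
  case (Suc d)
  define q where "q = k * 2 ^ ((card \<Gamma> + 1) * d)"
  have S: "2 * (2 ^ card \<Gamma> * q) \<le> card S"
    using Suc.prems by (simp add: q_def power_add mult_ac)
  then obtain A where A: "A \<subseteq> S" "card A = 2 ^ card \<Gamma> * q"
    using obtain_subset_with_card_n[of "2 ^ card \<Gamma> * q" S] by auto
  have "card (S - A) = card S - card A"
    using A Suc.prems by (meson card_Diff_subset finite_subset)
  then have "2 ^ card \<Gamma> * q \<le> card (S - A)" using S A by simp
  then obtain A' B' where AB: "A' \<subseteq> A" "B' \<subseteq> S - A" "q \<le> card A'" "q \<le> card B'"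
      "\<forall>\<tau>\<in>\<Gamma>. before \<tau> A' B' \<or> before \<tau> B' A'"
    using before_common[OF \<Gamma>, of A q "S - A"] A Suc.prems
    by (metis finite_Diff finite_subset order_refl)
  have fin: "finite A'" "finite B'" using AB A Suc.prems by (meson finite_Diff finite_subset)+
  obtain l where l: "full k d l" "elems l \<subseteq> A'" "\<forall>\<tau>\<in>\<Gamma>. compatible \<tau> l"
    using Suc.IH[OF fin(1)] AB q_def by blast
  obtain r where r: "full k d r" "elems r \<subseteq> B'" "\<forall>\<tau>\<in>\<Gamma>. compatible \<tau> r"
    using Suc.IH[OF fin(2)] AB q_def by blast
  have "\<forall>\<tau>\<in>\<Gamma>. before \<tau> (elems l) (elems r) \<or> before \<tau> (elems r) (elems l)"
    using AB(5) l(2) r(2) by (meson before_subset)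
  moreover have "elems l \<inter> elems r = {}" using AB l(2) r(2) by blast
  ultimately show ?case using l r AB A by (intro exI[of _ "Node l r"]) auto
qed

section \<open>Random subtrees\<close>

abbreviation expect :: "'a pmf \<Rightarrow> ('a \<Rightarrow> real) \<Rightarrow> real" where
  "expect p \<equiv> measure_pmf.expectation p"

lemma expect_bind:
  assumes "finite (set_pmf p)" "\<And>x. x \<in> set_pmf p \<Longrightarrow> finite (set_pmf (f x))"
  shows "expect (p \<bind> f) F = expect p (\<lambda>x. expect (f x) F)"
  using assms pmf_expectation_bind[of "set_pmf p" f p F]
  by (simp add: integral_measure_pmf[of "set_pmf p"])

lemma expect_mono:
  assumes "finite (set_pmf p)" "\<And>x. x \<in> set_pmf p \<Longrightarrow> F x \<le> G x"
  shows "expect p F \<le> expect p G"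
  using assms by (intro integral_mono_AE integrable_measure_pmf_finite) (auto simp: AE_measure_pmf_iff)

lemma expect_add:
  "finite (set_pmf p) \<Longrightarrow> expect p (\<lambda>x. F x + G x) = expect p F + expect p G"
  by (intro Bochner_Integration.integral_add integrable_measure_pmf_finite)

lemma expect_sum:
  "finite (set_pmf p) \<Longrightarrow> expect p (\<lambda>x. \<Sum>i\<in>I. F i x) = (\<Sum>i\<in>I. expect p (F i))"
  by (intro Bochner_Integration.integral_sum integrable_measure_pmf_finite)

lemma expect_lower:
  assumes "finite (set_pmf p)" "\<And>x. x \<in> set_pmf p \<Longrightarrow> a \<le> F x"
  shows "a \<le> expect p F"
  using expect_mono[of p "\<lambda>_. a" F] assms by auto

lemma expect_upper:
  assumes "finite (set_pmf p)" "\<And>x. x \<in> set_pmf p \<Longrightarrow> F x \<le> b"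
  shows "expect p F \<le> b"
  using expect_mono[of p F "\<lambda>_. b"] assms by auto

text \<open>Leaves are their own children, so that descending is total.\<close>

primrec lchild :: "etree \<Rightarrow> etree" where
  "lchild (Leaf C) = Leaf C"
| "lchild (Node l r) = l"

primrec rchild :: "etree \<Rightarrow> etree" where
  "rchild (Leaf C) = Leaf C"
| "rchild (Node l r) = r"

definition children :: "etree \<Rightarrow> etree pmf" where
  "children t = map_pmf (\<lambda>b. if b then lchild t else rchild t) (bernoulli_pmf (1/2))"

primrec descend :: "nat \<Rightarrow> etree \<Rightarrow> etree pmf" where
  "descend 0 t = return_pmf t"
| "descend (Suc d) t = children t \<bind> descend d"

lemma finite_children [simp]: "finite (set_pmf (children t))"
  by (simp add: children_def)

lemma set_children: "set_pmf (children t) \<subseteq> {lchild t, rchild t}"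
  by (auto simp: children_def)

lemma expect_children: "expect (children t) F = (F (lchild t) + F (rchild t)) / 2"
  by (simp add: children_def)

lemma finite_descend [simp]: "finite (set_pmf (descend d t))"
  by (induction d arbitrary: t) auto

lemma descend_add: "descend (d + e) t = descend d t \<bind> descend e"
proof (induction d arbitrary: t)
  case (Suc d)
  then have "descend (d + e) = (\<lambda>t. descend d t \<bind> descend e)" by auto
  then show ?case by (simp add: bind_assoc_pmf)
qed (simp add: bind_return_pmf)

lemma expect_descend_add: "expect (descend (d + e) t) F = expect (descend d t) (\<lambda>u. expect (descend e u) F)"
  by (simp add: descend_add expect_bind)

lemma expect_descend_Suc:
  "expect (descend (Suc d) t) F = (expect (descend d (lchild t)) F + expect (descend d (rchild t)) F) / 2"
  by (simp add: expect_bind expect_children)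

lemma descend_inv:
  assumes "u \<in> set_pmf (descend d t)"
  shows "elems u \<subseteq> elems t" "full k (d + e) t \<Longrightarrow> full k e u" "compatible \<tau> t \<Longrightarrow> compatible \<tau> u"
proof -
  have "elems u \<subseteq> elems t \<and> (full k (d + e) t \<longrightarrow> full k e u) \<and> (compatible \<tau> t \<longrightarrow> compatible \<tau> u)"
    using assms
  proof (induction d arbitrary: t)
    case (Suc d)
    then obtain t' where t': "t' = lchild t \<or> t' = rchild t" "u \<in> set_pmf (descend d t')"
      using set_children[of t] by (auto simp: children_def split: if_splits)
    show ?case using Suc.IH[OF t'(2)] t'(1) by (cases t) auto
  qed simp
  then show "elems u \<subseteq> elems t" "full k (d + e) t \<Longrightarrow> full k e u"
      "compatible \<tau> t \<Longrightarrow> compatible \<tau> u" by auto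
qed

text \<open>
  The left-hand side is the sum, over the level of one branching, of the average of \<open>f\<close> below the
  child \<open>c\<close> of a random node at that level, for an arbitrary choice \<open>c\<close> of children. In coordinates
  where the chosen child has bit \<open>0\<close>, it equals \<open>2\<^sup>-\<^sup>w \<Sum>\<^sub>x 2 Z(x) f(x)\<close>, with \<open>Z(x)\<close> the number of zeros
  of \<open>x \<in> {0, 1}\<^sup>w\<close>. As \<open>Z\<close> is concentrated near \<open>w / 2\<close>, this is close to \<open>w\<close> times the plain
  average of \<open>f\<close>. The parameter \<open>y\<close> records the value of \<open>2 Z - w\<close> on the levels already passed.
\<close>

lemma chosen_child_average_aux:
  fixes f :: "etree \<Rightarrow> real"
  assumes c: "\<And>u. c u = lchild u \<or> c u = rchild u"
    and f: "\<And>u. 0 \<le> f u" "\<And>u. f u \<le> F" and "0 < \<mu>"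
  shows "(\<Sum>i<w. expect (descend i t) (\<lambda>u. expect (descend (w - Suc i) (c u)) f))
      + (y - real w) * expect (descend w t) f \<le> F * ((y\<^sup>2 + real w) / (4 * \<mu>) + \<mu>)"
proof (induction w arbitrary: t y)
  case 0
  \<comment> \<open>With no levels left, all that is needed is
    \<open>y \<le> y\<^sup>2 / (4 * \<mu>) + \<mu>\<close>, a completed square.\<close>
  have "0 \<le> (y - 2 * \<mu>)\<^sup>2 / (4 * \<mu>)" using \<open>0 < \<mu>\<close> by simp
  also have "\<dots> = y\<^sup>2 / (4 * \<mu>) + \<mu> - y" using \<open>0 < \<mu>\<close> by (simp add: field_simps power2_eq_square)
  finally have "f t * y \<le> f t * (y\<^sup>2 / (4 * \<mu>) + \<mu>)" using f(1) by (intro mult_left_mono) auto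
  also have "\<dots> \<le> F * (y\<^sup>2 / (4 * \<mu>) + \<mu>)" using f(2) \<open>0 < \<mu>\<close> by (intro mult_right_mono) auto
  finally show ?case by (simp add: mult.commute)
next
  case (Suc w)
  define Q where "Q v t = (\<Sum>i<v. expect (descend i t) (\<lambda>u. expect (descend (v - Suc i) (c u)) f))" for v t
  define A where "A t = expect (descend w t) f" for t
  have "Q (Suc w) t = A (c t) + (\<Sum>i<w. expect (descend (Suc i) t) (\<lambda>u. expect (descend (w - Suc i) (c u)) f))"
    unfolding Q_def A_def by (simp add: sum.lessThan_Suc_shift del: sum.lessThan_Suc descend.simps(2))
  also have "\<dots> = A (c t) + (Q w (lchild t) + Q w (rchild t)) / 2"
    by (simp only: expect_descend_Suc Q_def sum.distrib add_divide_distrib sum_divide_distrib)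
  finally have Q: "Q (Suc w) t = A (c t) + (Q w (lchild t) + Q w (rchild t)) / 2" .
  have A: "expect (descend (Suc w) t) f = (A (lchild t) + A (rchild t)) / 2"
    by (simp only: A_def expect_descend_Suc)
  have IH: "Q w t + (y - real w) * A t \<le> F * ((y\<^sup>2 + real w) / (4 * \<mu>) + \<mu>)" for t y
    using Suc.IH[of t y] by (simp add: Q_def A_def)
  \<comment> \<open>The chosen child continues with \<open>y + 1\<close>, its sibling with
    \<open>y - 1\<close>. The average of the two squares is \<open>y\<^sup>2 + 1\<close>, which
    matches the increment from \<open>w\<close> to \<open>Suc w\<close> in the bound.\<close>
  have B: "F * (((y + 1)\<^sup>2 + real w) / (4 * \<mu>) + \<mu>) + F * (((y - 1)\<^sup>2 + real w) / (4 * \<mu>) + \<mu>)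
      = 2 * (F * ((y\<^sup>2 + real (Suc w)) / (4 * \<mu>) + \<mu>))"
    using \<open>0 < \<mu>\<close> by (simp add: field_simps power2_eq_square)
  have "Q (Suc w) t + (y - real (Suc w)) * expect (descend (Suc w) t) f
      \<le> F * ((y\<^sup>2 + real (Suc w)) / (4 * \<mu>) + \<mu>)"
  proof -
    have half: "(a + b) / 2 \<le> z" if "a \<le> p" "b \<le> q" "p + q = 2 * z" for a b p q z :: real
      using that by simp
    consider "c t = lchild t" | "c t = rchild t" using c by blast
    then show ?thesis
    proof cases
      case 1
      have "Q (Suc w) t + (y - real (Suc w)) * expect (descend (Suc w) t) f =
          ((Q w (lchild t) + (y + 1 - real w) * A (lchild t)) +
           (Q w (rchild t) + (y - 1 - real w) * A (rchild t))) / 2"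
        unfolding Q A 1 by (simp add: field_simps)
      then show ?thesis by (simp only: half[OF IH IH B])
    next
      case 2
      have "Q (Suc w) t + (y - real (Suc w)) * expect (descend (Suc w) t) f =
          ((Q w (rchild t) + (y + 1 - real w) * A (rchild t)) +
           (Q w (lchild t) + (y - 1 - real w) * A (lchild t))) / 2"
        unfolding Q A 2 by (simp add: field_simps)
      then show ?thesis by (simp only: half[OF IH IH B])
    qed
  qed
  then show ?case by (simp only: Q_def)
qed

text \<open>With \<open>y = 0\<close> and \<open>\<mu> = m / 2\<close> both error terms
  \<open>w / (4 * \<mu>)\<close> and \<open>\<mu>\<close> equal \<open>m / 2\<close>. Dividing the
  total error \<open>F * m\<close> by \<open>w = m * m\<close> leaves \<open>F / m\<close>.\<close>

lemma chosen_child_average: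
  fixes f :: "etree \<Rightarrow> real"
  assumes c: "\<And>u. c u = lchild u \<or> c u = rchild u"
    and f: "\<And>u. 0 \<le> f u" "\<And>u. f u \<le> F" and m: "0 < m" "w = m * m"
  shows "(\<Sum>i<w. expect (descend i t) (\<lambda>u. expect (descend (w - Suc i) (c u)) f)) / real w
     \<le> expect (descend w t) f + F / real m"
proof -
  have "(\<Sum>i<w. expect (descend i t) (\<lambda>u. expect (descend (w - Suc i) (c u)) f))
      \<le> real w * expect (descend w t) f + F * real m"
    using chosen_child_average_aux[where c = c and f = f and F = F and \<mu> = "real m / 2" and w = w and t = t and y = 0, OF c f] m
    by (simp add: field_simps)
  then show ?thesis using m by (simp add: field_simps)
qed

section \<open>The hard assignments\<close>

text \<open>
  Layer \<open>Suc h\<close> puts two independent copies of layer \<open>h\<close>, with top values that differ by a factor \<open>B\<close>,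
  below the children of a random node \<open>u\<close> at a random level \<open>i < w\<close>. As \<open>i\<close> is random, the place of the
  copy inspected first is distributed almost like that of a single random subtree.
\<close>

primrec hard :: "real \<Rightarrow> nat \<Rightarrow> nat \<Rightarrow> nat \<Rightarrow> etree \<Rightarrow> (nat \<Rightarrow> real) pmf" where
  "hard B w 0 s t = return_pmf (\<lambda>x. if x \<in> elems t then B ^ s else 0)"
| "hard B w (Suc h) s t =
     pmf_of_set {..<w} \<bind> (\<lambda>i. descend i t \<bind> (\<lambda>u.
     descend (w - Suc i) (lchild u) \<bind> (\<lambda>l. descend (w - Suc i) (rchild u) \<bind> (\<lambda>r.
     bernoulli_pmf (1/2) \<bind> (\<lambda>b.
     hard B w h (if b then Suc s else s) l \<bind> (\<lambda>f.
     map_pmf (\<lambda>g x. f x + g x) (hard B w h (if b then s else Suc s) r)))))))"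

text \<open>The optimum of such an assignment is \<open>k * B ^ e\<close>, and an element outside
  the top cluster is worth at most the fraction \<open>1 / B\<close> of one inside. Multiplying by
  \<open>B\<close> expresses this gap for \<open>e = 0\<close> as well.\<close>

definition peaked :: "real \<Rightarrow> nat \<Rightarrow> nat \<Rightarrow> nat set \<Rightarrow> (nat \<Rightarrow> real) \<Rightarrow> bool" where
  "peaked B k e S v \<longleftrightarrow> (\<forall>x. v x \<noteq> 0 \<longrightarrow> x \<in> S) \<and> (\<forall>x. 0 \<le> v x) \<and>
     (\<forall>x. v x = B ^ e \<or> B * v x \<le> B ^ e) \<and> finite {x. v x = B ^ e} \<and> card {x. v x = B ^ e} = k"

lemma peaked_le:
  assumes "1 < B" "peaked B k e S v"
  shows "v x \<le> B ^ e"
proof -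
  have "0 \<le> v x" "v x = B ^ e \<or> B * v x \<le> B ^ e" using assms(2) by (simp_all add: peaked_def)
  moreover from this have "1 * v x \<le> B * v x" using assms(1) by (intro mult_right_mono) auto
  ultimately show ?thesis by auto
qed

lemma peaked_less: "1 < B \<Longrightarrow> peaked B k e S v \<Longrightarrow> v x < B ^ Suc e"
  by (meson lessI order_le_less_trans peaked_le power_strict_increasing)

text \<open>The supports are disjoint and the peak of \<open>g\<close> lies a factor
  \<open>B\<close> below that of \<open>f\<close>, so the top cluster of the sum is that of
  \<open>f\<close>.\<close>

lemma peaked_add:
  assumes B: "1 < B" and f: "peaked B k (Suc e) S f" and g: "peaked B k e T g" and "S \<inter> T = {}"
  shows "peaked B k (Suc e) (S \<union> T) (\<lambda>x. f x + g x)"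
proof -
  note lt = peaked_less[OF B g]
  have top: "B ^ Suc e \<noteq> 0" using B by simp
  have disj: "f x = 0 \<or> g x = 0" for x using f g assms(4) unfolding peaked_def by blast
  have eq: "{x. f x + g x = B ^ Suc e} = {x. f x = B ^ Suc e}"
  proof -
    have "f x + g x = B ^ Suc e \<longleftrightarrow> f x = B ^ Suc e" for x
      using disj[of x] lt[of x] top by (auto simp del: power_Suc)
    then show ?thesis by simp
  qed
  have "f x + g x = B ^ Suc e \<or> B * (f x + g x) \<le> B ^ Suc e" for x
  proof (cases "g x = 0")
    case True
    then show ?thesis using f by (simp add: peaked_def)
  next
    case False
    then have "f x = 0" using disj[of x] by simp
    moreover have "B * g x \<le> B ^ Suc e" using peaked_le[OF B g, of x] B by simp
    ultimately show ?thesis by simp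
  qed
  moreover have "\<forall>x. 0 \<le> f x + g x" using f g by (simp add: peaked_def)
  moreover have "\<forall>x. f x + g x \<noteq> 0 \<longrightarrow> x \<in> S \<union> T" using f g by (force simp: peaked_def)
  ultimately show "peaked B k (Suc e) (S \<union> T) (\<lambda>x. f x + g x)"
    using f unfolding peaked_def eq by blast
qed

lemma peaked_mono: "peaked B k e S v \<Longrightarrow> S \<subseteq> T \<Longrightarrow> peaked B k e T v"
  by (auto simp: peaked_def)

lemma set_pmf_lessThan [simp]: "0 < w \<Longrightarrow> set_pmf (pmf_of_set {..<w}) = {..<w}" for w :: nat
  by (intro set_pmf_of_set) auto

lemma finite_hard [simp]: "0 < w \<Longrightarrow> finite (set_pmf (hard B w h s t))"
  by (induction h arbitrary: s t) auto

lemma branching_descendants: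
  assumes t: "full k (w * Suc h) t" and "i < w" and u: "u \<in> set_pmf (descend i t)"
    and l: "l \<in> set_pmf (descend (w - Suc i) (lchild u))"
    and r: "r \<in> set_pmf (descend (w - Suc i) (rchild u))"
  shows "full k (w * h) l" "full k (w * h) r" "elems l \<subseteq> elems (lchild u)"
    "elems r \<subseteq> elems (rchild u)" "elems (lchild u) \<inter> elems (rchild u) = {}"
    "elems l \<union> elems r \<subseteq> elems t"
    "compatible \<tau> t \<Longrightarrow> compatible \<tau> l" "compatible \<tau> t \<Longrightarrow> compatible \<tau> r"
    "compatible \<tau> t \<Longrightarrow> before \<tau> (elems (lchild u)) (elems (rchild u)) \<or>
       before \<tau> (elems (rchild u)) (elems (lchild u))"
proof -
  \<comment> \<open>Depth count: \<open>i\<close> levels down to \<open>u\<close>, one for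
    branching, \<open>w - Suc i\<close> more down to the copies, and \<open>w * h\<close> inside
    them. Hence \<open>u\<close> is a proper \<open>Node\<close>, and the convention for children of
    leaves does not interfere.\<close>
  have "w * Suc h = i + Suc ((w - Suc i) + w * h)" using \<open>i < w\<close> by simp
  then have u': "full k (Suc ((w - Suc i) + w * h)) u" using t descend_inv(2)[OF u] by metis
  then obtain a b where u_eq: "u = Node a b" by (cases u) auto
  note inv = descend_inv[OF u] descend_inv[OF l] descend_inv[OF r]
  show "full k (w * h) l" "full k (w * h) r" "elems l \<subseteq> elems (lchild u)"
    "elems r \<subseteq> elems (rchild u)" "elems (lchild u) \<inter> elems (rchild u) = {}"
    "elems l \<union> elems r \<subseteq> elems t"
    "compatible \<tau> t \<Longrightarrow> compatible \<tau> l" "compatible \<tau> t \<Longrightarrow> compatible \<tau> r"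
    "compatible \<tau> t \<Longrightarrow> before \<tau> (elems (lchild u)) (elems (rchild u)) \<or>
       before \<tau> (elems (rchild u)) (elems (lchild u))"
    using inv u' by (auto simp: u_eq)
qed

text \<open>Whatever the coin, the copy on scale \<open>Suc s\<close> provides the peak, as its
  exponent exceeds that of the other copy by one. Layer and scale thus enter the top value only
  through their sum.\<close>

lemma peaked_hard:
  assumes "1 < B" "0 < w" "full k (w * h) t" "v \<in> set_pmf (hard B w h s t)"
  shows "peaked B k (h + s) (elems t) v"
  using assms(3,4)
proof (induction h arbitrary: s t v)
  case 0
  then obtain C where C: "t = Leaf C" "finite C" "card C = k" by (cases t) auto
  have "B ^ s \<noteq> 0" using assms by simp
  moreover from this have "{x. (if x \<in> C then B ^ s else 0) = B ^ s} = C" by auto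
  ultimately show ?case using 0 C assms by (auto simp: peaked_def)
next
  case (Suc h)
  then obtain i u l r b f g where
    iu: "i < w" "u \<in> set_pmf (descend i t)" and
    lr: "l \<in> set_pmf (descend (w - Suc i) (lchild u))" "r \<in> set_pmf (descend (w - Suc i) (rchild u))" and
    fg: "f \<in> set_pmf (hard B w h (if b then Suc s else s) l)"
        "g \<in> set_pmf (hard B w h (if b then s else Suc s) r)" and v: "v = (\<lambda>x. f x + g x)"
    using assms(2) by (auto simp del: set_pmf_bernoulli)
  note br = branching_descendants[OF Suc.prems(1) iu lr]
  have disj: "elems l \<inter> elems r = {}" "elems r \<inter> elems l = {}" using br by blast+
  have pf: "peaked B k (h + (if b then Suc s else s)) (elems l) f"
    and pg: "peaked B k (h + (if b then s else Suc s)) (elems r) g"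
    using Suc.IH br fg by blast+
  show ?case
  proof (cases b)
    case True
    have "peaked B k (Suc (h + s)) (elems l \<union> elems r) v"
      using peaked_add[OF assms(1) _ _ disj(1)] pf pg True v by simp
    then show ?thesis using br(6) peaked_mono by simp
  next
    case False
    have "peaked B k (Suc (h + s)) (elems r \<union> elems l) (\<lambda>x. g x + f x)"
      using peaked_add[OF assms(1) _ _ disj(2)] pf pg False by simp
    then show ?thesis using br(6) peaked_mono v by (simp add: add.commute Un_commute)
  qed
qed

lemma expect_hard_Suc:
  assumes "0 < w"
  shows "expect (hard B w (Suc h) s t) F =
    (\<Sum>i<w. expect (descend i t) (\<lambda>u.
      expect (descend (w - Suc i) (lchild u)) (\<lambda>l. expect (descend (w - Suc i) (rchild u)) (\<lambda>r.
       (expect (hard B w h (Suc s) l) (\<lambda>f. expect (hard B w h s r) (\<lambda>g. F (\<lambda>x. f x + g x))) +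
        expect (hard B w h s l) (\<lambda>f. expect (hard B w h (Suc s) r) (\<lambda>g. F (\<lambda>x. f x + g x)))) / 2)))) / real w"
proof -
  have "{..<w} \<noteq> {}" using assms by auto
  then show ?thesis
    using assms by (simp add: expect_bind integral_pmf_of_set add_divide_distrib)
qed

section \<open>Online acceptance in a fixed order\<close>

lemma accepted_subset: "accepted n k rule \<pi> v t \<subseteq> \<pi> ` {1..t}"
proof (induction t)
  case (Suc t)
  moreover have "\<pi> ` {1..t} \<subseteq> \<pi> ` {1..Suc t}" by auto
  ultimately show ?case by (auto simp: Let_def)
qed simp

lemma finite_accepted [simp]: "finite (accepted n k rule \<pi> v t)"
  by (rule finite_subset[OF accepted_subset]) simp

lemma card_accepted_le: "card (accepted n k rule \<pi> v t) \<le> k"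
  by (induction t) (auto simp: Let_def card_insert_if)

lemma accepted_mono: "t \<le> u \<Longrightarrow> accepted n k rule \<pi> v t \<subseteq> accepted n k rule \<pi> v u"
  by (induction u rule: dec_induct) (auto simp: Let_def)

lemma accepted_new: "t \<le> u \<Longrightarrow> accepted n k rule \<pi> v u \<subseteq> accepted n k rule \<pi> v t \<union> \<pi> ` {t<..u}"
proof (induction u rule: dec_induct)
  case (step u)
  moreover have "\<pi> ` {t<..u} \<subseteq> \<pi> ` {t<..Suc u}" by auto
  moreover have "\<pi> (Suc u) \<in> \<pi> ` {t<..Suc u}" using step by auto
  ultimately show ?case by (auto simp: Let_def)
qed auto

text \<open>This is how ignorance of the future enters: each decision reads only
  \<open>observed\<close>, so assignments that agree so far cannot be told apart.\<close>

lemma accepted_cong: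
  "(\<And>i. i \<in> {1..t} \<Longrightarrow> f (\<pi> i) = g (\<pi> i)) \<Longrightarrow> accepted n k rule \<pi> f t = accepted n k rule \<pi> g t"
proof (induction t)
  case (Suc t)
  have "observed \<pi> f (Suc t) = observed \<pi> g (Suc t)"
    unfolding observed_def by (rule map_cong[OF refl]) (use Suc.prems in auto)
  moreover have "accepted n k rule \<pi> f t = accepted n k rule \<pi> g t" using Suc by auto
  ultimately show ?case by (simp only: accepted.simps)
qed simp

text \<open>Order and seed are fixed here, so the algorithm is a single deterministic
  \<open>rule\<close>; both are averaged over at the end.\<close>

locale online =
  fixes n k :: nat and rule :: "real list \<Rightarrow> bool" and \<pi> :: "nat \<Rightarrow> nat" and B :: real
  assumes \<pi>: "\<pi> permutes {1..n}" and k: "1 \<le> k" and B: "1 < B"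
begin

abbreviation acc :: "(nat \<Rightarrow> real) \<Rightarrow> nat \<Rightarrow> nat set" where
  "acc v t \<equiv> accepted n k rule \<pi> v t"

abbreviation \<tau> :: "nat \<Rightarrow> nat" where "\<tau> \<equiv> inv \<pi>"

definition last_time :: "(nat \<Rightarrow> real) \<Rightarrow> nat" where
  "last_time v = Max (\<tau> ` {x. v x \<noteq> 0})"

text \<open>The capacity, as a fraction of \<open>k\<close>, left after the last nonzero value. It
  acts as a potential: gains on a later copy are paid from the room that the earlier copy
  left.\<close>

definition room :: "(nat \<Rightarrow> real) \<Rightarrow> real" where
  "room v = 1 - real (card (acc v (last_time v))) / real k"

definition gain :: "nat \<Rightarrow> (nat \<Rightarrow> real) \<Rightarrow> real" where
  "gain e v = real (card {x \<in> acc v n. v x = B ^ e}) / real k"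

lemma room_bounds: "0 \<le> room v" "room v \<le> 1"
  using card_accepted_le[of n k rule \<pi> v "last_time v"] k by (auto simp: room_def field_simps)

lemma gain_bounds: "0 \<le> gain e v" "gain e v \<le> 1"
proof -
  have "card {x \<in> acc v n. v x = B ^ e} \<le> card (acc v n)" by (intro card_mono) auto
  also have "\<dots> \<le> k" by (rule card_accepted_le)
  finally show "0 \<le> gain e v" "gain e v \<le> 1" using k by (auto simp: gain_def field_simps)
qed

lemma time_of_time [simp]: "\<tau> (\<pi> i) = i" "\<pi> (\<tau> x) = x"
  using permutes_inverses[OF \<pi>] by auto

lemma acc_early:
  assumes "x \<in> acc v u" "\<tau> x \<le> t" shows "x \<in> acc v t"
proof (cases "t \<le> u")
  case True
  then show ?thesis using accepted_new[OF True, of n k rule \<pi> v] assms by auto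
next
  case False
  then show ?thesis using accepted_mono[of u t n k rule \<pi> v] assms by auto
qed

lemma time_range: "x \<in> {1..n} \<Longrightarrow> \<tau> x \<in> {1..n}"
  using permutes_in_image[OF permutes_inv[OF \<pi>]] by blast

text \<open>As \<open>g\<close> lives after \<open>f\<close>, the run on the sum agrees with the run
  on \<open>f\<close> until \<open>last_time f\<close>. If the value \<open>B ^ c\<close> occurs
  only in \<open>f\<close>, all its gain is made by then and room can only shrink. If it occurs only
  in \<open>g\<close>, its acceptances come out of the room left by \<open>f\<close>.\<close>

lemma two_phases:
  fixes f g :: "nat \<Rightarrow> real"
  defines "v \<equiv> (\<lambda>x. f x + g x)"
  assumes f: "peaked B k d S f" and g: "peaked B k e T g" and ST: "S \<subseteq> {1..n}" "T \<subseteq> {1..n}"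
    and b: "before \<tau> S T"
  shows "(\<And>x. g x \<noteq> B ^ c) \<Longrightarrow> gain c v + room v \<le> gain c f + room f"
    and "(\<And>x. f x \<noteq> B ^ c) \<Longrightarrow> gain c v + room v \<le> room f"
proof -
  have supp: "f x \<noteq> 0 \<Longrightarrow> x \<in> S" "g x \<noteq> 0 \<Longrightarrow> x \<in> T" for x
    using f g by (auto simp: peaked_def)
  have fin: "finite {x. f x \<noteq> 0}" "finite {x. v x \<noteq> 0}"
  proof -
    have "f x \<noteq> 0 \<or> g x \<noteq> 0" if "v x \<noteq> 0" for x using that by (auto simp: v_def)
    then have "{x. f x \<noteq> 0} \<subseteq> S" "{x. v x \<noteq> 0} \<subseteq> S \<union> T" using supp by blast+
    moreover have "finite S" "finite T" using ST by (auto intro: finite_subset)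
    ultimately show "finite {x. f x \<noteq> 0}" "finite {x. v x \<noteq> 0}" by (auto intro: finite_subset)
  qed
  have v_or: "(f x \<noteq> 0 \<and> g x = 0 \<and> v x = f x) \<or> (f x = 0 \<and> g x \<noteq> 0 \<and> v x = g x) \<or> (f x = 0 \<and> g x = 0 \<and> v x = 0)" for x
    using supp[of x] b by (auto simp: before_def v_def)
  have B0: "B ^ j \<noteq> 0" for j using B by simp
  have "{x. f x = B ^ d} \<noteq> {}" using f k unfolding peaked_def by (metis card.empty not_one_le_zero)
  then have ne: "{x. f x \<noteq> 0} \<noteq> {}" using B0 by force
  have f_time: "\<tau> x \<le> last_time f" if "f x \<noteq> 0" for x
    unfolding last_time_def by (rule Max_ge) (use fin that in auto)
  have v_time: "\<tau> x \<le> last_time v" if "v x \<noteq> 0" for x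
    unfolding last_time_def by (rule Max_ge) (use fin that in auto)
  have "last_time f \<in> \<tau> ` {x. f x \<noteq> 0}"
    unfolding last_time_def by (rule Max_in) (use fin ne in auto)
  then obtain z where z: "last_time f = \<tau> z" "f z \<noteq> 0" by auto
  have "v z \<noteq> 0" using v_or[of z] z by auto
  then have le: "last_time f \<le> last_time v" using v_time z by simp
  have g_late: "last_time f < \<tau> x" if "g x \<noteq> 0" for x
    using b supp(1)[OF z(2)] supp(2)[OF that] by (auto simp: z before_def)
  have same: "acc v (last_time f) = acc f (last_time f)"
  proof (rule accepted_cong)
    fix i assume "i \<in> {1..last_time f}"
    then have "g (\<pi> i) = 0" using g_late[of "\<pi> i"] by auto
    then show "v (\<pi> i) = f (\<pi> i)" by (simp add: v_def)
  qed
  have z_n: "last_time f \<le> n" using time_range[of z] supp(1)[OF z(2)] ST z by auto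
  have room_le: "room v \<le> room f"
    using card_mono[OF _ accepted_mono[OF le, of n k rule \<pi> v]] k
    by (simp add: room_def same divide_right_mono)
  show "gain c v + room v \<le> gain c f + room f" if "\<And>x. g x \<noteq> B ^ c"
  proof -
    have "{x \<in> acc v n. v x = B ^ c} \<subseteq> {x \<in> acc f n. f x = B ^ c}"
    proof
      fix x assume x: "x \<in> {x \<in> acc v n. v x = B ^ c}"
      then have "f x \<noteq> 0" "f x = B ^ c" using v_or[of x] that[of x] B0[of c] by auto
      moreover have "x \<in> acc f n"
        using acc_early[of x v n "last_time f"] x f_time[OF \<open>f x \<noteq> 0\<close>] same accepted_mono[OF z_n, of n k rule \<pi> f]
        by auto
      ultimately show "x \<in> {x \<in> acc f n. f x = B ^ c}" by simp
    qed
    then have "card {x \<in> acc v n. v x = B ^ c} \<le> card {x \<in> acc f n. f x = B ^ c}"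
      by (intro card_mono) auto
    then have "gain c v \<le> gain c f" using k by (simp add: gain_def divide_right_mono)
    then show ?thesis using room_le by simp
  qed
  show "gain c v + room v \<le> room f" if "\<And>x. f x \<noteq> B ^ c"
  proof -
    \<comment> \<open>The elements counted here belong to \<open>g\<close>, so they are decided
      after \<open>last_time f\<close> and no later than \<open>last_time v\<close>.\<close>
    have "{x \<in> acc v n. v x = B ^ c} \<subseteq> acc v (last_time v) - acc v (last_time f)"
    proof
      fix x assume x: "x \<in> {x \<in> acc v n. v x = B ^ c}"
      then have gx: "g x \<noteq> 0" and vx: "v x \<noteq> 0" using v_or[of x] that[of x] B0[of c] by auto
      have "x \<notin> acc v (last_time f)"
        using g_late[OF gx] accepted_subset[of n k rule \<pi> v "last_time f"] by auto
      moreover have "x \<in> acc v (last_time v)" using acc_early v_time[OF vx] x by blast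
      ultimately show "x \<in> acc v (last_time v) - acc v (last_time f)" by simp
    qed
    then have "card {x \<in> acc v n. v x = B ^ c} \<le> card (acc v (last_time v) - acc v (last_time f))"
      by (intro card_mono) auto
    also have "\<dots> = card (acc v (last_time v)) - card (acc v (last_time f))"
      using accepted_mono[OF le] by (intro card_Diff_subset) auto
    finally have "card {x \<in> acc v n. v x = B ^ c} + card (acc v (last_time f)) \<le> card (acc v (last_time v))"
      using card_mono[OF _ accepted_mono[OF le, of n k rule \<pi> v]] by simp
    then have "real (card {x \<in> acc v n. v x = B ^ c}) + real (card (acc f (last_time f)))
        \<le> real (card (acc v (last_time v)))" using same by (metis of_nat_add of_nat_le_iff)
    from divide_right_mono[OF this, of "real k"] show ?thesis
      by (simp add: gain_def room_def add_divide_distrib)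
  qed
qed

end

section \<open>Recursion over the layers in a fixed order\<close>

context online
begin

text \<open>The exponent \<open>Suc (h + s)\<close> is the peak of the copy on scale
  \<open>Suc s\<close>, and the other copy stays strictly below it. So the scales alone decide which
  case of \<open>two_phases\<close> applies.\<close>

lemma expect_two_phases:
  fixes s :: nat
  assumes w: "0 < w" and full: "full k (w * h) a" "full k (w * h) b"
    and sub: "elems a \<subseteq> {1..n}" "elems b \<subseteq> {1..n}" and bef: "before \<tau> (elems a) (elems b)"
  defines "\<Phi> \<equiv> (\<lambda>v. gain (Suc (h + s)) v + room v)"
  shows "f \<in> set_pmf (hard B w h (Suc s) a) \<Longrightarrow> g \<in> set_pmf (hard B w h s b) \<Longrightarrow>
      \<Phi> (\<lambda>x. f x + g x) \<le> gain (Suc (h + s)) f + room f"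
    and "f \<in> set_pmf (hard B w h s a) \<Longrightarrow> g \<in> set_pmf (hard B w h (Suc s) b) \<Longrightarrow>
      \<Phi> (\<lambda>x. f x + g x) \<le> room f"
proof -
  note pk = peaked_hard[OF B w]
  show "\<Phi> (\<lambda>x. f x + g x) \<le> gain (Suc (h + s)) f + room f"
    if "f \<in> set_pmf (hard B w h (Suc s) a)" "g \<in> set_pmf (hard B w h s b)"
  proof -
    have "g x \<noteq> B ^ Suc (h + s)" for x
      using peaked_less[OF B pk[OF full(2) that(2)], of x] by simp
    then show ?thesis unfolding \<Phi>_def
      by (intro two_phases(1)[OF pk[OF full(1) that(1)] pk[OF full(2) that(2)] sub bef])
  qed
  show "\<Phi> (\<lambda>x. f x + g x) \<le> room f"
    if "f \<in> set_pmf (hard B w h s a)" "g \<in> set_pmf (hard B w h (Suc s) b)"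
  proof -
    have "f x \<noteq> B ^ Suc (h + s)" for x
      using peaked_less[OF B pk[OF full(1) that(1)], of x] by simp
    then show ?thesis unfolding \<Phi>_def
      by (intro two_phases(2)[OF pk[OF full(1) that(1)] pk[OF full(2) that(2)] sub bef])
  qed
qed

definition gain_avg :: "nat \<Rightarrow> nat \<Rightarrow> nat \<Rightarrow> etree \<Rightarrow> real" where
  "gain_avg w h s t = expect (hard B w h s t) (gain (h + s))"

definition room_avg :: "nat \<Rightarrow> nat \<Rightarrow> nat \<Rightarrow> etree \<Rightarrow> real" where
  "room_avg w h s t = expect (hard B w h s t) room"

lemma avg_bounds:
  assumes "0 < w"
  shows "0 \<le> gain_avg w h s t" "gain_avg w h s t \<le> 1" "0 \<le> room_avg w h s t" "room_avg w h s t \<le> 1"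
  unfolding gain_avg_def room_avg_def
  by (rule expect_lower expect_upper finite_hard[OF assms] gain_bounds room_bounds)+

text \<open>On compatible nodes this is the child inspected first. Where neither order holds the
  right child is taken, so that the choice is total, as \<open>chosen_child_average\<close>
  requires.\<close>

definition first_child :: "etree \<Rightarrow> etree" where
  "first_child u = (if before \<tau> (elems (lchild u)) (elems (rchild u)) then lchild u else rchild u)"

text \<open>With probability 1/2 the first copy holds the peak and its gain and room count;
  otherwise only its room does. Both bounds involve the first copy alone, so the second one averages
  out.\<close>

lemma layer_single:
  assumes w: "0 < w" and t: "full k (w * Suc h) t" "compatible \<tau> t" "elems t \<subseteq> {1..n}"
  shows "gain_avg w (Suc h) s t + room_avg w (Suc h) s t \<le>
    (\<Sum>i<w. expect (descend i t) (\<lambda>u. expect (descend (w - Suc i) (first_child u))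
       (\<lambda>a. (gain_avg w h (Suc s) a + room_avg w h (Suc s) a + room_avg w h s a) / 2))) / real w"
proof -
  define \<Phi> where "\<Phi> v = gain (Suc (h + s)) v + room v" for v
  define H where "H a = (gain_avg w h (Suc s) a + room_avg w h (Suc s) a + room_avg w h s a) / 2" for a
  have fin: "finite (set_pmf (hard B w h s' t'))" for s' t' using w by simp
  define J where "J l r = (expect (hard B w h (Suc s) l) (\<lambda>f. expect (hard B w h s r) (\<lambda>g. \<Phi> (\<lambda>x. f x + g x))) +
        expect (hard B w h s l) (\<lambda>f. expect (hard B w h (Suc s) r) (\<lambda>g. \<Phi> (\<lambda>x. f x + g x)))) / 2" for l r
  have main: "expect (descend (w - Suc i) (lchild u)) (\<lambda>l. expect (descend (w - Suc i) (rchild u)) (J l))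
      \<le> expect (descend (w - Suc i) (first_child u)) H"
    if iu: "i < w" "u \<in> set_pmf (descend i t)" for i u
  proof (cases "before \<tau> (elems (lchild u)) (elems (rchild u))")
    case True
    have J: "J l r \<le> H l"
      if lr: "l \<in> set_pmf (descend (w - Suc i) (lchild u))" "r \<in> set_pmf (descend (w - Suc i) (rchild u))" for l r
    proof -
      note br = branching_descendants[OF t(1) iu lr]
      have sub: "elems l \<subseteq> {1..n}" "elems r \<subseteq> {1..n}" using br(6) t(3) by auto
      have bef: "before \<tau> (elems l) (elems r)" using before_subset[OF True br(3,4)] .
      note tp = expect_two_phases[OF w br(1,2) sub bef]
      have "expect (hard B w h (Suc s) l) (\<lambda>f. expect (hard B w h s r) (\<lambda>g. \<Phi> (\<lambda>x. f x + g x)))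
          \<le> expect (hard B w h (Suc s) l) (\<lambda>f. expect (hard B w h s r) (\<lambda>g. gain (Suc (h + s)) f + room f))"
        unfolding \<Phi>_def by (intro expect_mono fin tp(1))
      also have "\<dots> = gain_avg w h (Suc s) l + room_avg w h (Suc s) l"
        by (simp add: gain_avg_def room_avg_def expect_add[OF fin])
      finally have 1: "expect (hard B w h (Suc s) l) (\<lambda>f. expect (hard B w h s r) (\<lambda>g. \<Phi> (\<lambda>x. f x + g x)))
        \<le> gain_avg w h (Suc s) l + room_avg w h (Suc s) l" .
      have "expect (hard B w h s l) (\<lambda>f. expect (hard B w h (Suc s) r) (\<lambda>g. \<Phi> (\<lambda>x. f x + g x)))
          \<le> expect (hard B w h s l) (\<lambda>f. expect (hard B w h (Suc s) r) (\<lambda>g. room f))"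
        unfolding \<Phi>_def by (intro expect_mono fin tp(2))
      also have "\<dots> = room_avg w h s l" by (simp add: room_avg_def)
      finally show ?thesis using 1 by (simp add: J_def H_def)
    qed
    have "expect (descend (w - Suc i) (lchild u)) (\<lambda>l. expect (descend (w - Suc i) (rchild u)) (J l))
        \<le> expect (descend (w - Suc i) (lchild u)) (\<lambda>l. expect (descend (w - Suc i) (rchild u)) (\<lambda>r. H l))"
      by (intro expect_mono finite_descend J)
    then show ?thesis using True by (simp add: first_child_def)
  next
    case False
    \<comment> \<open>Mirror image: the right copy comes first, so the summands are swapped before
      \<open>expect_two_phases\<close> applies.\<close>
    have J: "J l r \<le> H r"
      if lr: "l \<in> set_pmf (descend (w - Suc i) (lchild u))" "r \<in> set_pmf (descend (w - Suc i) (rchild u))" for l r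
    proof -
      note br = branching_descendants[OF t(1) iu lr]
      have sub: "elems l \<subseteq> {1..n}" "elems r \<subseteq> {1..n}" using br(6) t(3) by auto
      have bef: "before \<tau> (elems r) (elems l)" using before_subset[OF _ br(4,3)] br(9)[OF t(2)] False by blast
      note tp = expect_two_phases[OF w br(2,1) sub(2,1) bef]
      have swap: "(\<lambda>x. f x + g x) = (\<lambda>x. g x + f x)" for f g :: "nat \<Rightarrow> real" by (simp add: add.commute)
      have "expect (hard B w h s l) (\<lambda>f. expect (hard B w h (Suc s) r) (\<lambda>g. \<Phi> (\<lambda>x. f x + g x)))
          \<le> expect (hard B w h s l) (\<lambda>f. expect (hard B w h (Suc s) r) (\<lambda>g. gain (Suc (h + s)) g + room g))"
      proof (intro expect_mono fin)
        fix f g assume "f \<in> set_pmf (hard B w h s l)" "g \<in> set_pmf (hard B w h (Suc s) r)"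
        then show "\<Phi> (\<lambda>x. f x + g x) \<le> gain (Suc (h + s)) g + room g"
          unfolding swap[of f g] \<Phi>_def by (intro tp(1))
      qed
      also have "\<dots> = gain_avg w h (Suc s) r + room_avg w h (Suc s) r"
        by (simp add: gain_avg_def room_avg_def expect_add[OF fin])
      finally have 1: "expect (hard B w h s l) (\<lambda>f. expect (hard B w h (Suc s) r) (\<lambda>g. \<Phi> (\<lambda>x. f x + g x)))
        \<le> gain_avg w h (Suc s) r + room_avg w h (Suc s) r" .
      have "expect (hard B w h (Suc s) l) (\<lambda>f. expect (hard B w h s r) (\<lambda>g. \<Phi> (\<lambda>x. f x + g x)))
          \<le> expect (hard B w h (Suc s) l) (\<lambda>f. expect (hard B w h s r) room)"
      proof (intro expect_mono fin)
        fix f g assume "f \<in> set_pmf (hard B w h (Suc s) l)" "g \<in> set_pmf (hard B w h s r)"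
        then show "\<Phi> (\<lambda>x. f x + g x) \<le> room g"
          unfolding swap[of f g] \<Phi>_def by (intro tp(2))
      qed
      also have "\<dots> = room_avg w h s r" by (simp add: room_avg_def)
      finally show ?thesis using 1 by (simp add: J_def H_def)
    qed
    have "expect (descend (w - Suc i) (lchild u)) (\<lambda>l. expect (descend (w - Suc i) (rchild u)) (J l))
        \<le> expect (descend (w - Suc i) (lchild u)) (\<lambda>l. expect (descend (w - Suc i) (rchild u)) H)"
      by (intro expect_mono finite_descend J)
    then show ?thesis using False by (simp add: first_child_def)
  qed
  have "gain_avg w (Suc h) s t + room_avg w (Suc h) s t = expect (hard B w (Suc h) s t) \<Phi>"
    unfolding gain_avg_def room_avg_def \<Phi>_def using finite_hard[OF w] by (simp add: expect_add del: hard.simps)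
  also have "\<dots> = (\<Sum>i<w. expect (descend i t) (\<lambda>u.
      expect (descend (w - Suc i) (lchild u)) (\<lambda>l. expect (descend (w - Suc i) (rchild u)) (J l)))) / real w"
    unfolding expect_hard_Suc[OF w] J_def ..
  also have "\<dots> \<le> (\<Sum>i<w. expect (descend i t) (\<lambda>u. expect (descend (w - Suc i) (first_child u)) H)) / real w"
    by (intro divide_right_mono sum_mono expect_mono finite_descend main) auto
  finally show ?thesis unfolding H_def .
qed

text \<open>Summed over \<open>s\<close>, the scales \<open>s\<close> and \<open>Suc s\<close> give
  the same sum up to boundary terms, which cost at most 1. Replacing the first child by a random one
  costs \<open>3/2\<close>, since the averaged function is at most \<open>3/2 * m\<close>. Gain is
  carried over with weight 1/2, room with weight 1.\<close>

lemma layer: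
  assumes m: "0 < m" "w = m * m" and t: "full k (w * Suc h) t" "compatible \<tau> t" "elems t \<subseteq> {1..n}"
  shows "(\<Sum>s<m. gain_avg w (Suc h) s t) + (\<Sum>s<m. room_avg w (Suc h) s t) \<le>
    expect (descend w t) (\<lambda>u. (\<Sum>s<m. gain_avg w h s u) / 2 + (\<Sum>s<m. room_avg w h s u)) + 5/2"
proof -
  have w: "0 < w" using m by simp
  define f where "f u = (\<Sum>s<m. gain_avg w h s u) / 2 + (\<Sum>s<m. room_avg w h s u)" for u
  define H where "H s a = (gain_avg w h (Suc s) a + room_avg w h (Suc s) a + room_avg w h s a) / 2" for s a
  have shift: "(\<Sum>s<m. F (Suc s)) = (\<Sum>s<m. F s) + F m - F 0" for F :: "nat \<Rightarrow> real"
    using sum.lessThan_Suc_shift[of F m] by simp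
  have H_le: "(\<Sum>s<m. H s a) \<le> f a + 1" for a
    unfolding H_def sum_divide_distrib[symmetric] sum.distrib shift[of "\<lambda>s. gain_avg w h s a"]
      shift[of "\<lambda>s. room_avg w h s a"] f_def
    using avg_bounds[OF w, of h m a] avg_bounds[OF w, of h 0 a] by (simp add: field_simps)
  have f0: "0 \<le> f u" for u
    unfolding f_def by (intro add_nonneg_nonneg divide_nonneg_nonneg sum_nonneg avg_bounds[OF w]) auto
  have fm: "f u \<le> 3 / 2 * real m" for u
  proof -
    have "(\<Sum>s<m. gain_avg w h s u) \<le> (\<Sum>s<m. 1)" "(\<Sum>s<m. room_avg w h s u) \<le> (\<Sum>s<m. 1)"
      by (intro sum_mono avg_bounds[OF w])+
    then show ?thesis by (simp add: f_def)
  qed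
  have c: "first_child u = lchild u \<or> first_child u = rchild u" for u by (simp add: first_child_def)
  have "(\<Sum>s<m. gain_avg w (Suc h) s t) + (\<Sum>s<m. room_avg w (Suc h) s t)
      \<le> (\<Sum>s<m. (\<Sum>i<w. expect (descend i t) (\<lambda>u. expect (descend (w - Suc i) (first_child u)) (H s))) / real w)"
    unfolding sum.distrib[symmetric] H_def by (intro sum_mono layer_single[OF w t])
  also have "\<dots> = (\<Sum>i<w. expect (descend i t) (\<lambda>u. expect (descend (w - Suc i) (first_child u)) (\<lambda>a. \<Sum>s<m. H s a))) / real w"
    unfolding sum_divide_distrib[symmetric] by (subst sum.swap) (simp add: expect_sum)
  also have "\<dots> \<le> (\<Sum>i<w. expect (descend i t) (\<lambda>u. expect (descend (w - Suc i) (first_child u)) (\<lambda>a. f a + 1))) / real w"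
    by (intro divide_right_mono sum_mono expect_mono finite_descend H_le) auto
  also have "\<dots> = (\<Sum>i<w. expect (descend i t) (\<lambda>u. expect (descend (w - Suc i) (first_child u)) f)) / real w + 1"
    using w by (simp add: expect_add sum.distrib add_divide_distrib)
  also have "\<dots> \<le> expect (descend w t) f + (3 / 2 * real m) / real m + 1"
    using chosen_child_average[OF c f0 fm m, of t] by simp
  finally show ?thesis using m unfolding f_def by simp
qed

text \<open>Each step of the recursion carries over only half of the previous gain. The other halves
  accumulate on the left, so half of all gains together is at most
  \<open>p 0 / 2 + r 0 + 5/2 * m \<le> 4 * m\<close>.\<close>

lemma sum_gain:
  assumes m: "0 < m" "w = m * m" and T: "full k (w * m) T" "compatible \<tau> T" "elems T \<subseteq> {1..n}"
  shows "(\<Sum>h<m. \<Sum>s<m. expect (descend (w * (m - Suc h)) T) (gain_avg w (Suc h) s)) \<le> 8 * real m"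
proof -
  have w: "0 < w" using m by simp
  define p where "p h = expect (descend (w * (m - h)) T) (\<lambda>u. \<Sum>s<m. gain_avg w h s u)" for h
  define r where "r h = expect (descend (w * (m - h)) T) (\<lambda>u. \<Sum>s<m. room_avg w h s u)" for h
  have step: "p (Suc h) + r (Suc h) \<le> p h / 2 + r h + 5/2" if "h < m" for h
  proof -
    \<comment> \<open>All layers share one tree: layer \<open>Suc h\<close> starts at depth
      \<open>w * (m - Suc h)\<close>, and descending \<open>w\<close> further levels leads to the
      starting depth of layer \<open>h\<close>.\<close>
    have d: "w * m = w * (m - Suc h) + w * Suc h"
      using that by (simp add: distrib_left[symmetric] del: mult_Suc_right)
    have d': "w * (m - h) = w * (m - Suc h) + w"
      using Suc_diff_Suc[OF that] by (metis mult_Suc_right add.commute)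
    have "p (Suc h) + r (Suc h) = expect (descend (w * (m - Suc h)) T)
        (\<lambda>u. (\<Sum>s<m. gain_avg w (Suc h) s u) + (\<Sum>s<m. room_avg w (Suc h) s u))"
      by (simp add: p_def r_def expect_add)
    also have "\<dots> \<le> expect (descend (w * (m - Suc h)) T) (\<lambda>u. expect (descend w u)
        (\<lambda>u. (\<Sum>s<m. gain_avg w h s u) / 2 + (\<Sum>s<m. room_avg w h s u)) + 5/2)"
    proof (intro expect_mono finite_descend layer[OF m])
      fix u assume u: "u \<in> set_pmf (descend (w * (m - Suc h)) T)"
      show "full k (w * Suc h) u" using descend_inv(2)[OF u, of k "w * Suc h"] T(1) d by simp
      show "compatible \<tau> u" using descend_inv(3)[OF u] T(2) by simp
      show "elems u \<subseteq> {1..n}" using descend_inv(1)[OF u] T(3) by simp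
    qed
    also have "\<dots> = p h / 2 + r h + 5/2"
      unfolding p_def r_def d' by (simp add: expect_add expect_descend_add)
    finally show ?thesis .
  qed
  have "(\<Sum>h<j. p (Suc h)) / 2 + p j / 2 + r j \<le> p 0 / 2 + r 0 + 5/2 * real j" if "j \<le> m" for j
    using that
  proof (induction j)
    case (Suc j)
    then show ?case using step[of j] by (simp add: field_simps)
  qed simp
  from this[of m] have tot: "(\<Sum>h<m. p (Suc h)) / 2 + p m / 2 + r m \<le> p 0 / 2 + r 0 + 5/2 * real m" by simp
  have bd: "0 \<le> p h" "p h \<le> real m" "0 \<le> r h" "r h \<le> real m" for h
  proof -
    have "(\<Sum>s<m. gain_avg w h s u) \<le> (\<Sum>s<m. 1)" "(\<Sum>s<m. room_avg w h s u) \<le> (\<Sum>s<m. 1)" for u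
      by (intro sum_mono avg_bounds[OF w])+
    then have le: "(\<Sum>s<m. gain_avg w h s u) \<le> real m" "(\<Sum>s<m. room_avg w h s u) \<le> real m" for u
      by simp_all
    show "0 \<le> p h" "p h \<le> real m" "0 \<le> r h" "r h \<le> real m"
      unfolding p_def r_def
      by (rule expect_lower expect_upper finite_descend sum_nonneg avg_bounds[OF w] le)+
  qed
  have "(\<Sum>h<m. p (Suc h)) \<le> 8 * real m" using tot bd[of m] bd[of 0] by simp
  then show ?thesis unfolding p_def by (simp add: expect_sum)
qed

end

section \<open>The mixture over layers and scales, and its competitive ratio\<close>

definition adversary :: "real \<Rightarrow> nat \<Rightarrow> etree \<Rightarrow> (nat \<Rightarrow> real) pmf" where
  "adversary B m T = pmf_of_set {..<m} \<bind> (\<lambda>h. pmf_of_set {..<m} \<bind> (\<lambda>s.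
     descend (m * m * (m - Suc h)) T \<bind> hard B (m * m) (Suc h) s))"

lemma finite_adversary: "0 < m \<Longrightarrow> finite (set_pmf (adversary B m T))"
  by (simp add: adversary_def del: hard.simps)

text \<open>The starting depth \<open>m * m * (m - Suc h)\<close> leaves exactly the
  \<open>m * m * Suc h\<close> levels that layer \<open>Suc h\<close> needs. The exponent of the
  peak varies with the draw.\<close>

lemma peaked_adversary:
  assumes "1 < B" "0 < m" "full k (m * m * m) T" "v \<in> set_pmf (adversary B m T)"
  obtains e where "peaked B k e (elems T) v"
proof -
  obtain h s u where *: "h < m" "u \<in> set_pmf (descend (m * m * (m - Suc h)) T)"
      "v \<in> set_pmf (hard B (m * m) (Suc h) s u)"
    using assms(2,4) by (auto simp: adversary_def simp del: hard.simps)
  have "m * m * m = m * m * (m - Suc h) + m * m * Suc h"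
    using *(1) by (simp add: distrib_left[symmetric] del: mult_Suc_right)
  then have "full k (m * m * Suc h) u" using descend_inv(2)[OF *(2), of k "m * m * Suc h"] assms(3) by simp
  then have "peaked B k (Suc h + s) (elems u) v" using peaked_hard[OF assms(1) _ _ *(3)] assms(2) by simp
  then show ?thesis using that peaked_mono descend_inv(1)[OF *(2)] by blast
qed

text \<open>As \<open>c\<close> is an upper bound, sorting moves all its \<open>k\<close> copies to
  the end of the list.\<close>

lemma sum_largest_top:
  assumes le: "\<And>i. i \<in> {1..n} \<Longrightarrow> v i \<le> c" and k: "card {i \<in> {1..n}. v i = c} = k"
  shows "sum_largest n k v = real k * c"
proof -
  define xs where "xs = map v [1..<Suc n]"
  have le': "\<forall>x\<in>set xs. x \<le> c" using le by (auto simp: xs_def)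
  have "length (filter (\<lambda>x. x = c) xs) = length (filter (\<lambda>i. v i = c) [1..<Suc n])"
    by (simp add: xs_def length_filter_map o_def del: upt_Suc)
  also have "\<dots> = card (set (filter (\<lambda>i. v i = c) [1..<Suc n]))"
    by (intro distinct_card[symmetric] distinct_filter distinct_upt)
  also have "set (filter (\<lambda>i. v i = c) [1..<Suc n]) = {i \<in> {1..n}. v i = c}" by auto
  finally have len: "length (filter (\<lambda>x. x = c) xs) = k" using k by simp
  have "filter (\<lambda>x. x = c) xs = replicate k c"
    using len by (intro replicate_eqI) auto
  moreover have "mset (filter (\<lambda>x. x \<noteq> c) xs @ filter (\<lambda>x. x = c) xs) = mset xs"
    by (induction xs) auto
  ultimately have "mset (sort (filter (\<lambda>x. x \<noteq> c) xs) @ replicate k c) = mset xs" by simp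
  moreover have "sorted (sort (filter (\<lambda>x. x \<noteq> c) xs) @ replicate k c)"
    using le' by (auto simp: sorted_append)
  ultimately have "sort xs = sort (filter (\<lambda>x. x \<noteq> c) xs) @ replicate k c"
    by (metis properties_for_sort)
  then have "take k (rev (sort xs)) = replicate k c" by simp
  then show ?thesis unfolding sum_largest_def xs_def by (simp add: sum_list_replicate)
qed

lemma sum_largest_peaked:
  assumes "1 < B" "peaked B k e S v" "S \<subseteq> {1..n}"
  shows "sum_largest n k v = real k * B ^ e"
proof (rule sum_largest_top)
  have "B ^ e \<noteq> 0" using assms(1) by simp
  then have "{i. v i = B ^ e} \<subseteq> {1..n}" using assms(2,3) by (force simp: peaked_def)
  then have "{i \<in> {1..n}. v i = B ^ e} = {i. v i = B ^ e}" by auto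
  then show "card {i \<in> {1..n}. v i = B ^ e} = k" using assms(2) by (simp add: peaked_def)
qed (use peaked_le[OF assms(1,2)] in auto)

context online
begin

definition ratio :: "(nat \<Rightarrow> real) \<Rightarrow> real" where
  "ratio v = sum v (acc v n) / sum_largest n k v"

text \<open>At most \<open>k\<close> elements are accepted, and each one outside the top cluster is
  worth at most \<open>B ^ e / B\<close>; together these make up at most the fraction
  \<open>1 / B\<close> of the optimum.\<close>

lemma ratio_peaked:
  assumes v: "peaked B k e S v" "S \<subseteq> {1..n}"
  shows "ratio v \<le> gain e v + 1 / B" "ratio v \<le> 1"
proof -
  have pos: "0 < B ^ e" using B by simp
  define A where "A = {x \<in> acc v n. v x = B ^ e}"
  have A: "A \<subseteq> acc v n" by (auto simp: A_def)
  have card: "card (acc v n) \<le> k" by (rule card_accepted_le)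
  have small: "v x \<le> B ^ e / B" if "x \<in> acc v n - A" for x
    using v(1) that B by (auto simp: peaked_def A_def field_simps)
  have "sum v (acc v n) = sum v (acc v n - A) + sum v A" by (rule sum.subset_diff[OF A]) simp
  also have "\<dots> \<le> (\<Sum>x\<in>acc v n - A. B ^ e / B) + (\<Sum>x\<in>A. B ^ e)"
    using small by (intro add_mono sum_mono) (auto simp: A_def)
  also have "\<dots> = real (card (acc v n - A)) * (B ^ e / B) + real (card A) * B ^ e" by simp
  also have "\<dots> \<le> real k * (B ^ e / B) + real (card A) * B ^ e"
    using card_mono[OF _ Diff_subset, of "acc v n" A] card pos B
    by (intro add_right_mono mult_right_mono) auto
  finally show "ratio v \<le> gain e v + 1 / B"
    unfolding ratio_def sum_largest_peaked[OF B v] gain_def A_def[symmetric]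
    using k pos B by (simp add: field_simps)
  have "sum v (acc v n) \<le> (\<Sum>x\<in>acc v n. B ^ e)" by (intro sum_mono peaked_le[OF B v(1)])
  also have "\<dots> \<le> real k * B ^ e" using card pos by simp
  finally show "ratio v \<le> 1" unfolding ratio_def sum_largest_peaked[OF B v] using k pos by simp
qed

text \<open>The \<open>m * m\<close> pairs of layer and scale share a total gain of at most
  \<open>8 * m\<close>, hence \<open>8 / m\<close> on average; \<open>1 / B\<close> accounts for the
  lower clusters.\<close>

lemma expect_ratio:
  assumes m: "0 < m" and T: "full k (m * m * m) T" "compatible \<tau> T" "elems T \<subseteq> {1..n}"
  shows "expect (adversary B m T) ratio \<le> 8 / real m + 1 / B"
proof -
  define w where "w = m * m"
  have w: "0 < w" using m by (simp add: w_def)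
  have fin: "finite (set_pmf (hard B w h s t))" for h s t using w by simp
  have inner: "expect (hard B w (Suc h) s u) ratio \<le> gain_avg w (Suc h) s u + 1 / B"
    if "h < m" "u \<in> set_pmf (descend (w * (m - Suc h)) T)" for h s u
  proof -
    have "w * m = w * (m - Suc h) + w * Suc h"
      using that by (simp add: distrib_left[symmetric] del: mult_Suc_right)
    then have u: "full k (w * Suc h) u"
      using descend_inv(2)[OF that(2), of k "w * Suc h"] T(1) w_def by simp
    have "elems u \<subseteq> {1..n}" using descend_inv(1)[OF that(2)] T(3) by simp
    then have "expect (hard B w (Suc h) s u) ratio \<le> expect (hard B w (Suc h) s u) (\<lambda>v. gain (Suc h + s) v + 1 / B)"
      by (intro expect_mono fin ratio_peaked(1)[OF peaked_hard[OF B w u]])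
    also have "\<dots> = gain_avg w (Suc h) s u + 1 / B"
      using fin by (simp add: gain_avg_def expect_add del: hard.simps)
    finally show ?thesis .
  qed
  have ne: "{..<m} \<noteq> {}" using m by auto
  have "expect (adversary B m T) ratio =
      (\<Sum>h<m. \<Sum>s<m. expect (descend (w * (m - Suc h)) T) (\<lambda>u. expect (hard B w (Suc h) s u) ratio)) / (real m * real m)"
    unfolding adversary_def w_def[symmetric] using m w fin ne
    by (simp add: expect_bind integral_pmf_of_set sum_divide_distrib mult.commute del: hard.simps)
  also have "\<dots> \<le> (\<Sum>h<m. \<Sum>s<m. expect (descend (w * (m - Suc h)) T) (\<lambda>u. gain_avg w (Suc h) s u + 1 / B)) / (real m * real m)"
    by (intro divide_right_mono sum_mono expect_mono finite_descend inner) auto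
  also have "\<dots> = (\<Sum>h<m. \<Sum>s<m. expect (descend (w * (m - Suc h)) T) (gain_avg w (Suc h) s)) / (real m * real m) + 1 / B"
    using m by (simp add: expect_add sum.distrib add_divide_distrib)
  also have "\<dots> \<le> 8 * real m / (real m * real m) + 1 / B"
    using sum_gain[OF m w_def _ T(2,3)] T(1) by (intro add_right_mono divide_right_mono) (auto simp: w_def)
  finally show ?thesis using m by simp
qed

end

section \<open>Entropy and the choice of parameters\<close>

text \<open>The orders in \<open>G\<close> have total probability at most 1, which bounds their
  number. Every other order contributes at least \<open>log 2 L\<close> times its probability to the
  entropy, as in Markov's inequality.\<close>

lemma heavy_orders:
  fixes L :: real
  assumes D: "order_distribution n D" and L: "1 < L"
  defines "G \<equiv> {\<pi>. \<pi> permutes {1..n} \<and> 1 / L \<le> pmf D \<pi>}"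
  shows "real (card G) \<le> L"
    and "(\<Sum>\<pi> | \<pi> permutes {1..n} \<and> \<pi> \<notin> G. pmf D \<pi>) \<le> order_entropy n D / log 2 L"
proof -
  let ?P = "{\<pi>. \<pi> permutes {1..n}}"
  have fin: "finite ?P" by (simp add: finite_permutations)
  have G: "G \<subseteq> ?P" by (auto simp: G_def)
  have one: "(\<Sum>\<pi>\<in>?P. pmf D \<pi>) = 1"
    using D fin by (intro sum_pmf_eq_1) (auto simp: order_distribution_def)
  have "real (card G) * (1 / L) = (\<Sum>\<pi>\<in>G. 1 / L)" by simp
  also have "\<dots> \<le> (\<Sum>\<pi>\<in>G. pmf D \<pi>)" by (intro sum_mono) (auto simp: G_def)
  also have "\<dots> \<le> (\<Sum>\<pi>\<in>?P. pmf D \<pi>)" using G fin by (intro sum_mono2) auto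
  finally show "real (card G) \<le> L" using one L by (simp add: field_simps)
  have nonneg: "0 \<le> - (pmf D \<pi> * log 2 (pmf D \<pi>))" for \<pi>
  proof (cases "pmf D \<pi> = 0")
    case False
    then have "log 2 (pmf D \<pi>) \<le> 0" using pmf_le_1[of D \<pi>] pmf_nonneg[of D \<pi>] by simp
    then show ?thesis by (simp add: mult_nonneg_nonpos)
  qed simp
  have light: "pmf D \<pi> * log 2 L \<le> - (pmf D \<pi> * log 2 (pmf D \<pi>))" if "\<pi> \<in> ?P - G" for \<pi>
  proof (cases "pmf D \<pi> = 0")
    case False
    then have pos: "0 < pmf D \<pi>" using pmf_nonneg[of D \<pi>] by linarith
    have "pmf D \<pi> < 1 / L" using that by (auto simp: G_def)
    then have "log 2 (pmf D \<pi>) \<le> log 2 (1 / L)" using pos L by simp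
    then have "log 2 L \<le> - log 2 (pmf D \<pi>)" using L by (simp add: log_divide)
    then have "pmf D \<pi> * log 2 L \<le> pmf D \<pi> * - log 2 (pmf D \<pi>)" by (rule mult_left_mono) simp
    then show ?thesis by simp
  qed simp
  have "(\<Sum>\<pi>\<in>?P - G. pmf D \<pi>) * log 2 L \<le> (\<Sum>\<pi>\<in>?P - G. - (pmf D \<pi> * log 2 (pmf D \<pi>)))"
    unfolding sum_distrib_right by (intro sum_mono light)
  also have "\<dots> \<le> (\<Sum>\<pi>\<in>?P. - (pmf D \<pi> * log 2 (pmf D \<pi>)))"
    using fin nonneg by (intro sum_mono2) auto
  also have "\<dots> = order_entropy n D" by (simp add: order_entropy_def sum_negf)
  finally have "(\<Sum>\<pi>\<in>?P - G. pmf D \<pi>) \<le> order_entropy n D / log 2 L"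
    using L by (simp add: field_simps)
  moreover have "?P - G = {\<pi>. \<pi> permutes {1..n} \<and> \<pi> \<notin> G}" by auto
  ultimately show "(\<Sum>\<pi> | \<pi> permutes {1..n} \<and> \<pi> \<notin> G. pmf D \<pi>) \<le> order_entropy n D / log 2 L" by simp
qed

text \<open>Each step queries the rule on one list that does not depend on the seed. The predicate
  \<open>P\<close> is arbitrary because the induction absorbs the update of the accepted set into
  it.\<close>

lemma sets_accepted:
  assumes "randomized_algorithm M alg"
  shows "{\<omega> \<in> space M. P (accepted n k (alg \<omega> \<pi>) \<pi> v t)} \<in> sets M"
proof (induction t arbitrary: P)
  case 0
  then show ?case by (cases "P {}") auto
next
  case (Suc t)
  let ?A = "\<lambda>\<omega>. accepted n k (alg \<omega> \<pi>) \<pi> v t"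
  let ?b = "\<lambda>\<omega>. alg \<omega> \<pi> (observed \<pi> v (Suc t))"
  define next_set where "next_set b A = (if card A < k \<and> (b \<or> n - t \<le> k - card A) then insert (\<pi> (Suc t)) A else A)" for b A
  have "{\<omega> \<in> space M. ?b \<omega>} \<in> sets M"
    using assms by (simp add: randomized_algorithm_def)
  then have "{\<omega> \<in> space M. (?b \<omega> \<and> P (next_set True (?A \<omega>))) \<or> (\<not> ?b \<omega> \<and> P (next_set False (?A \<omega>)))} \<in> sets M"
    using Suc[of "\<lambda>A. P (next_set True A)"] Suc[of "\<lambda>A. P (next_set False A)"]
    by (intro sets.sets_Collect_disj sets.sets_Collect_conj sets.sets_Collect_neg)
  moreover have "accepted n k (alg \<omega> \<pi>) \<pi> v (Suc t) = next_set (?b \<omega>) (?A \<omega>)" for \<omega>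
    by (simp add: next_set_def Let_def)
  then have "P (accepted n k (alg \<omega> \<pi>) \<pi> v (Suc t)) \<longleftrightarrow>
      (?b \<omega> \<and> P (next_set True (?A \<omega>))) \<or> (\<not> ?b \<omega> \<and> P (next_set False (?A \<omega>)))" for \<omega>
    by (cases "?b \<omega>") (simp_all del: accepted.simps)
  ultimately show ?case by (simp del: accepted.simps)
qed

text \<open>Only finitely many sets can be accepted, so the sum of \<open>\<bar>F A\<bar>\<close>
  over all of them is a uniform bound.\<close>

lemma integrable_accepted:
  fixes F :: "nat set \<Rightarrow> real"
  assumes "randomized_algorithm M alg"
  shows "integrable M (\<lambda>\<omega>. F (accepted n k (alg \<omega> \<pi>) \<pi> v t))"
proof -
  interpret prob_space M using assms by (simp add: randomized_algorithm_def)
  have meas: "(\<lambda>\<omega>. F (accepted n k (alg \<omega> \<pi>) \<pi> v t)) \<in> borel_measurable M"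
  proof (rule measurableI)
    fix S :: "real set"
    show "(\<lambda>\<omega>. F (accepted n k (alg \<omega> \<pi>) \<pi> v t)) -` S \<inter> space M \<in> sets M"
      using sets_accepted[OF assms, of "\<lambda>A. F A \<in> S" n k \<pi> v t]
      by (simp add: vimage_def Int_def conj_commute)
  qed simp
  have "\<bar>F A\<bar> \<le> (\<Sum>A\<in>Pow (\<pi> ` {1..t}). \<bar>F A\<bar>)" if "A \<subseteq> \<pi> ` {1..t}" for A
    using that by (intro member_le_sum) auto
  then show ?thesis
    using accepted_subset[of n k _ \<pi> v t]
    by (intro integrable_const_bound[OF _ meas, of "\<Sum>A\<in>Pow (\<pi> ` {1..t}). \<bar>F A\<bar>"]) auto
qed

text \<open>Yao's averaging: a ratio valid for every assignment holds on average over
  \<open>adversary\<close>, and once the expectations are exchanged each order and seed is judged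
  separately. Orders in \<open>G\<close> achieve at most \<open>c / 2\<close>; the others contribute
  at most their total probability, which is at most \<open>2 / 9 * c\<close>.\<close>

lemma not_achieves_ratio:
  fixes M :: "'s measure" and alg :: "'s algorithm" and c :: real
  assumes k: "1 \<le> k" and D: "order_distribution n D" and alg: "randomized_algorithm M alg"
    and c: "0 < c" "c < 1" and L: "1 < L" and H: "order_entropy n D / log 2 L \<le> 2 / 9 * c"
    and m: "0 < m" "8 / real m \<le> c / 4" and n: "real k * 2 powr ((L + 1) * real (m * m * m)) \<le> real n"
  shows "\<not> achieves_ratio n k D M alg c"
proof
  assume ach: "achieves_ratio n k D M alg c"
  interpret prob_space M using alg by (simp add: randomized_algorithm_def)
  \<comment> \<open>Then \<open>1 / B = c / 4\<close>, the same share as allowed for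
    \<open>8 / m\<close>.\<close>
  define B where "B = 4 / c"
  have B: "1 < B" using c by (simp add: B_def field_simps)
  let ?P = "{\<pi>. \<pi> permutes {1..n}}"
  have fin: "finite ?P" by (simp add: finite_permutations)
  define G where "G = {\<pi>. \<pi> permutes {1..n} \<and> 1 / L \<le> pmf D \<pi>}"
  note heavy = heavy_orders[OF D L, folded G_def]
  have GP: "G \<subseteq> ?P" by (auto simp: G_def)
  have finG: "finite (inv ` G)" using finite_subset[OF GP fin] by simp
  have "card (inv ` G) \<le> card G" using finite_subset[OF GP fin] by (rule card_image_le)
  then have cardG: "real (card (inv ` G)) \<le> L" using heavy(1) by linarith
  have "real (k * 2 ^ ((card (inv ` G) + 1) * (m * m * m))) =
      real k * 2 powr ((real (card (inv ` G)) + 1) * real (m * m * m))"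
    by (simp add: powr_realpow[symmetric] algebra_simps)
  also have "\<dots> \<le> real k * 2 powr ((L + 1) * real (m * m * m))"
    using cardG by (intro mult_left_mono powr_mono mult_right_mono) auto
  also note n
  finally have size: "k * 2 ^ ((card (inv ` G) + 1) * (m * m * m)) \<le> card {1..n}"
    by (simp only: of_nat_le_iff card_atLeastAtMost diff_Suc_1 add_diff_cancel_right' Suc_eq_plus1)
  have "inj \<tau>" if "\<tau> \<in> inv ` G" for \<tau>
    using that GP permutes_inv permutes_inj by blast
  from compatible_tree_exists[OF finG this finite_atLeastAtMost size]
  obtain T where T: "full k (m * m * m) T" "elems T \<subseteq> {1..n}" "\<And>\<pi>. \<pi> \<in> G \<Longrightarrow> compatible (inv \<pi>) T"
    by auto
  define A where "A = adversary B m T"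
  define R where "R \<pi> \<omega> v = online.ratio n k (alg \<omega> \<pi>) \<pi> v" for \<pi> \<omega> v
  have online: "online n k \<pi> B" if "\<pi> permutes {1..n}" for \<pi>
    using that k B by unfold_locales
  have R_eq: "R \<pi> \<omega> v = sum v (accepted n k (alg \<omega> \<pi>) \<pi> v n) / sum_largest n k v"
    if "\<pi> permutes {1..n}" for \<pi> \<omega> v
    unfolding R_def by (rule online.ratio_def[OF online[OF that]])
  have R_int: "integrable M (\<lambda>\<omega>. R \<pi> \<omega> v)" if "\<pi> permutes {1..n}" for \<pi> v
    unfolding R_eq[OF that] by (rule integrable_accepted[OF alg])
  have finA: "finite (set_pmf A)" using m by (simp add: A_def finite_adversary)
  have v_bound: "c \<le> (\<Sum>\<pi>\<in>?P. pmf D \<pi> * (\<integral>\<omega>. R \<pi> \<omega> v \<partial>M))" if v: "v \<in> set_pmf A" for v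
  proof -
    obtain e where e: "peaked B k e (elems T) v"
      using peaked_adversary[OF B m(1) T(1)] v unfolding A_def by blast
    have "sum_largest n k v = real k * B ^ e" by (rule sum_largest_peaked[OF B e T(2)])
    then have pos: "0 < sum_largest n k v" using k B by simp
    have "c * sum_largest n k v \<le> expected_value n k D M alg v"
      using ach e by (simp add: achieves_ratio_def peaked_def)
    also have "\<dots> = (\<Sum>\<pi>\<in>?P. (\<integral>\<omega>. sum v (accepted n k (alg \<omega> \<pi>) \<pi> v n) \<partial>M) * pmf D \<pi>)"
      unfolding expected_value_def using D fin
      by (intro integral_measure_pmf_real) (auto simp: order_distribution_def)
    also have "\<dots> = (\<Sum>\<pi>\<in>?P. pmf D \<pi> * (\<integral>\<omega>. R \<pi> \<omega> v \<partial>M)) * sum_largest n k v"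
      unfolding sum_distrib_right
    proof (rule sum.cong[OF refl])
      fix \<pi> assume "\<pi> \<in> ?P"
      then have "(\<integral>\<omega>. R \<pi> \<omega> v \<partial>M) * sum_largest n k v = (\<integral>\<omega>. sum v (accepted n k (alg \<omega> \<pi>) \<pi> v n) \<partial>M)"
        using pos by (simp add: R_eq)
      then show "(\<integral>\<omega>. sum v (accepted n k (alg \<omega> \<pi>) \<pi> v n) \<partial>M) * pmf D \<pi> =
          pmf D \<pi> * (\<integral>\<omega>. R \<pi> \<omega> v \<partial>M) * sum_largest n k v" by (simp add: mult.assoc)
    qed
    finally show ?thesis using pos by simp
  qed
  \<comment> \<open>The support of \<open>A\<close> is finite, so linearity of the integral takes
    the place of Fubini.\<close>
  have swap: "expect A (\<lambda>v. \<integral>\<omega>. R \<pi> \<omega> v \<partial>M) = (\<integral>\<omega>. expect A (R \<pi> \<omega>) \<partial>M)"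
    and int: "integrable M (\<lambda>\<omega>. expect A (R \<pi> \<omega>))" if "\<pi> permutes {1..n}" for \<pi>
    using R_int[OF that] by (simp_all add: integral_measure_pmf[OF finA])
  have "c \<le> expect A (\<lambda>v. \<Sum>\<pi>\<in>?P. pmf D \<pi> * (\<integral>\<omega>. R \<pi> \<omega> v \<partial>M))"
    by (intro expect_lower finA v_bound)
  also have "\<dots> = (\<Sum>\<pi>\<in>?P. pmf D \<pi> * (\<integral>\<omega>. expect A (R \<pi> \<omega>) \<partial>M))"
    using swap by (simp add: expect_sum[OF finA])
  also have "\<dots> \<le> (\<Sum>\<pi>\<in>?P. pmf D \<pi> * (if \<pi> \<in> G then c / 2 else 1))"
  proof (intro sum_mono mult_left_mono pmf_nonneg)
    fix \<pi> assume "\<pi> \<in> ?P"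
    then have \<pi>: "\<pi> permutes {1..n}" by simp
    have "expect A (R \<pi> \<omega>) \<le> (if \<pi> \<in> G then c / 2 else 1)" for \<omega>
    proof (cases "\<pi> \<in> G")
      case True
      have "expect A (R \<pi> \<omega>) \<le> 8 / real m + 1 / B"
        unfolding A_def R_def by (rule online.expect_ratio[OF online[OF \<pi>] m(1) T(1) T(3)[OF True] T(2)])
      then show ?thesis using m(2) True c by (simp add: B_def)
    next
      case False
      have "R \<pi> \<omega> v \<le> 1" if "v \<in> set_pmf A" for v
      proof -
        obtain e where "peaked B k e (elems T) v"
          using peaked_adversary[OF B m(1) T(1)] \<open>v \<in> set_pmf A\<close> unfolding A_def by blast
        from online.ratio_peaked(2)[OF online[OF \<pi>] this T(2)] show ?thesis by (simp add: R_def)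
      qed
      then have "expect A (R \<pi> \<omega>) \<le> 1" by (intro expect_upper finA)
      then show ?thesis using False by simp
    qed
    then have "(\<integral>\<omega>. expect A (R \<pi> \<omega>) \<partial>M) \<le> (\<integral>\<omega>. (if \<pi> \<in> G then c / 2 else 1) \<partial>M)"
      using int[OF \<pi>] by (intro integral_mono) auto
    then show "(\<integral>\<omega>. expect A (R \<pi> \<omega>) \<partial>M) \<le> (if \<pi> \<in> G then c / 2 else 1)" by (simp add: prob_space)
  qed
  also have "\<dots> \<le> (\<Sum>\<pi>\<in>?P. pmf D \<pi> * (c / 2) + (if \<pi> \<notin> G then pmf D \<pi> else 0))"
    using c by (intro sum_mono) auto
  also have "\<dots> = (\<Sum>\<pi>\<in>?P. pmf D \<pi>) * (c / 2) + (\<Sum>\<pi> | \<pi> permutes {1..n} \<and> \<pi> \<notin> G. pmf D \<pi>)"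
    unfolding sum.distrib sum_distrib_right[symmetric]
    using sum.inter_filter[OF fin, of "pmf D" "\<lambda>\<pi>. \<pi> \<notin> G"] by simp
  also have "(\<Sum>\<pi>\<in>?P. pmf D \<pi>) = 1"
    using D fin by (intro sum_pmf_eq_1) (auto simp: order_distribution_def)
  \<comment> \<open>Impossible for positive \<open>c\<close>, as
    \<open>1/2 + 2/9 < 1\<close>.\<close>
  finally have "c \<le> c / 2 + 2 / 9 * c" using heavy(2) H by linarith
  then show False using c by simp
qed

theorem theorem2:
  fixes a \<epsilon> :: real
  assumes "0 < a" and "a < 1" and "0 < \<epsilon>" and "\<epsilon> < 1"
  shows "\<forall>\<^sub>F n :: nat in sequentially.
    \<forall>(k :: nat) (D :: (nat \<Rightarrow> nat) pmf) (M :: 's measure) (alg :: 's algorithm).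
      1 \<le> k \<and> k \<le> n \<and> real k \<le> log 2 (real n) powr a \<and>
      order_distribution n D \<and> order_entropy n D \<le> (1 - \<epsilon>) / 9 * log 2 (log 2 (real n)) \<and>
      randomized_algorithm M alg
      \<longrightarrow> \<not> achieves_ratio n k D M alg (1 - \<epsilon>)"
proof -
  define c where "c = 1 - \<epsilon>"
  have c: "0 < c" "c < 1" using assms by (auto simp: c_def)
  \<comment> \<open>\<open>m\<close> is chosen from \<open>\<epsilon>\<close> alone, so the tree
    depth \<open>m * m * m\<close> stays constant while \<open>n\<close> grows.\<close>
  obtain m :: nat where "32 / c < real m" using reals_Archimedean2 by blast
  then have m: "0 < m" "8 / real m \<le> c / 4"
  proof -
    have "0 < 32 / c" using c by simp
    then have "0 < real m" using \<open>32 / c < real m\<close> by linarith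
    then show "0 < m" "8 / real m \<le> c / 4" using \<open>32 / c < real m\<close> c by (auto simp: field_simps)
  qed
  define d where "d = real (m * m * m)"
  have "d > 0" using m by (simp add: d_def)
  \<comment> \<open>\<open>n\<close> is 2 to the power \<open>log 2 n\<close>, whereas the exponent
    on the left grows only like the square root of \<open>log 2 n\<close>. The leading factor
    \<open>log 2 n\<close> makes space for \<open>k\<close>.\<close>
  then have "\<forall>\<^sub>F n :: nat in sequentially. log 2 (real n) * 2 powr ((sqrt (log 2 (real n)) + 1) * d) \<le> real n"
    by real_asymp
  moreover have "\<forall>\<^sub>F n :: nat in sequentially. 1 < log 2 (real n)" by real_asymp
  ultimately show ?thesis
  proof eventually_elim
    case (elim n)
    define x where "x = log 2 (real n)"
    have x: "1 < x" using elim by (simp add: x_def)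
    show ?case
    proof (intro allI impI)
      fix k :: nat and D :: "(nat \<Rightarrow> nat) pmf" and M :: "'s measure" and alg :: "'s algorithm"
      assume *: "1 \<le> k \<and> k \<le> n \<and> real k \<le> log 2 (real n) powr a \<and>
        order_distribution n D \<and> order_entropy n D \<le> (1 - \<epsilon>) / 9 * log 2 (log 2 (real n)) \<and>
        randomized_algorithm M alg"
      \<comment> \<open>The threshold \<open>L = sqrt x\<close> leaves at most \<open>sqrt x\<close>
        heavy orders, few enough for the tree, while \<open>log 2 L\<close> is still half of
        \<open>log 2 x\<close>. This turns the factor \<open>1/9\<close> of the entropy bound into
        the probability \<open>2/9 * c\<close> of the light orders.\<close>
      have L: "1 < sqrt x" using x by simp
      have log_sqrt: "log 2 (sqrt x) = log 2 x / 2"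
        using x by (simp add: log_def ln_sqrt)
      have "0 < log 2 x" using x by simp
      moreover have "order_entropy n D \<le> c / 9 * log 2 x" using * by (simp add: x_def c_def)
      ultimately have H: "order_entropy n D / log 2 (sqrt x) \<le> 2 / 9 * c"
        unfolding log_sqrt by (simp add: field_simps)
      have "real k \<le> x powr a" using * by (simp add: x_def)
      also have "\<dots> \<le> x powr 1" using x assms by (intro powr_mono) auto
      finally have "real k \<le> x" using x by simp
      then have "real k * 2 powr ((sqrt x + 1) * real (m * m * m)) \<le> real n"
        using elim(1) unfolding x_def[symmetric] d_def[symmetric]
        by (meson mult_right_mono order_trans powr_ge_zero)
      then have "\<not> achieves_ratio n k D M alg c"
        using * by (intro not_achieves_ratio[OF _ _ _ c L H m]) auto
      then show "\<not> achieves_ratio n k D M alg (1 - \<epsilon>)" by (simp add: c_def)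
    qed
  qed
qed

end
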